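(* Let $\sigma:C\to C$ be a surjective local homeomorphism of a compact space $C$, let $\alpha$ be the endomorphism $f\mapsto f\circ\sigma$ of $C(C)$, let $L$ be the transfer operator $L(f)(c)=\frac1{|\sigma^{-1}(c)|}\sum_{\sigma(d)=c}f(d)$, and suppose that $\{m_j:j\ge0\}$ is a (finite or countably infinite) Parseval frame for $M_L$ with $\langle m_0,m_0\rangle=1$. Suppose that $X$ is a Hilbert $C(C)$-module, that $\phi\in X$ satisfies $\langle\phi,\phi\rangle=1$, and that $D:X\to X_L$ is an isomorphism of Hilbert $C(C)$-modules such that $D\phi=\phi\cdot m_0$. Then $$\{\phi\}\cup\Big\{D^{-k}\Big(\phi\cdot\Big(\prod_{l=1}^k\alpha^{l-1}(m_{j_l})\Big)\Big):k\ge1,\ j_l\ge0\text{ and }j_1>0\Big\}$$ is a Parseval frame for the submodule $Q((M_L)_\infty)$ of $X$, where $Q:(M_L)_\infty\to X$ is the inner-product preserving map such that $Q(\iota^0(1))=\phi$ and $D\circ Q=Q\circ R$. If $\{m_j\}$ is an orthonormal basis for $M_L$, then the displayed family is an orthonormal basis for $Q((M_L)_\infty)$.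
   Context: Compact spaces are Hausdorff. Hilbert modules are right Hilbert modules with inner product linear in the second variable. $M_L$ is the correspondence over $A=C(C)$ obtained by giving the vector space $C(C)$ the right action $n\cdot a=n\alpha(a)$, left action $a\cdot n=an$ and inner product $\langle n,n'\rangle=L(n^*n')$; it is already complete in the associated norm (which is equivalent to the sup norm), so its underlying space is $C(C)$. For a Hilbert $C(C)$-module $X$, $X_L$ denotes the vector space $X$ with right action $x\cdot_La=x\cdot\alpha(a)$ and inner product $\langle x,y\rangle_L=L(\langle x,y\rangle)$; this is also complete (norm equivalent to that of $X$), so $D$ is a linear bijection $X\to X$ with $D(x\cdot f)=(Dx)\cdot\alpha(f)$ and $L(\langle Dx,Dy\rangle)=\langle x,y\rangle$, and $D^{-k}$ is its ordinary $k$-th inverse power. In $\phi\cdot m_0$ and $\phi\cdot(\prod\cdots)$ the dot is the original action of $C(C)$ on $X$, and products are taken in $C(C)$. $X_L$ is isomorphic to the internal tensor product $X\otimes_{C(C)}M_L$ via $x\otimes a\mapsto x\cdot a$. The $k$-fold internal tensor power $M_L^{\otimes k}$ ($M_L^{\otimes0}=C(C)$) is identified with $M_{L^k}$ (defined as $M_L$ but using $\alpha^k$, $L^k$; underlying space $C(C)$) via $n_1\otimes\cdots\otimes n_k\mapsto n_1\alpha(n_2)\cdots\alpha^{k-1}(n_k)$. $((M_L)_\infty,\iota^k)$ is the Hilbert-module direct limit of $T_k:M_L^{\otimes k}\to M_L^{\otimes(k+1)}$, $T_kn=m_0\otimes n$ ($T_0a=m_0\cdot a$); under the identification $T_k$ is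 $n\mapsto m_0\alpha(n)$. (The direct limit of inner-product preserving maps is the completion of the quotient of $\bigsqcup_kM_{L^k}$ identifying $n\in M_{L^k}$ with $T_kn\in M_{L^{k+1}}$; $\iota^k$ are the canonical maps.) $R:(M_L)_\infty\to((M_L)_\infty)_L$ is the Hilbert-module isomorphism obtained from the isomorphism $(M_L)_\infty\to(M_L)_\infty\otimes_{C(C)}M_L$ satisfying $R\circ\iota^{k+1}=\iota^k\otimes\mathrm{id}$; concretely $R(\iota^{k+1}(n))=\iota^k(n)$ for $n\in C(C)$. The map $Q$ is known to exist, and is unique. A countable family $\{x_j:j\in J\}$ in a Hilbert module $Z$ over a unital $C^*$-algebra is a Parseval frame for $Z$ if $\langle x,x\rangle=\sum_{j}\langle x,x_j\rangle\langle x_j,x\rangle$ for every $x\in Z$, with norm convergence. It is an orthonormal basis if it generates $Z$ (as a closed submodule) and $\langle x_j,x_k\rangle=\delta_{j,k}1$. The displayed set is a family indexed by tuples $(j_1,\dots,j_k)$ together with the extra element $\phi$. *)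

theory Defs
  imports "HOL-Analysis.Analysis"
begin

section \<open>The algebra of continuous functions\<close>

text \<open>On a compact space every continuous function is bounded, so there the library type
  \<^typ>\<open>'c \<Rightarrow>\<^sub>C complex\<close>, with its supremum norm, is the \<open>C\<^sup>*\<close>-algebra of
  all continuous complex functions.\<close>

unbundle bcontfun.lifting

instantiation bcontfun :: (topological_space, real_normed_field) comm_ring_1
begin

lift_definition one_bcontfun :: "'a \<Rightarrow>\<^sub>C 'b" is "\<lambda>_. 1"
  by (rule const_bcontfun)

lift_definition times_bcontfun :: "('a \<Rightarrow>\<^sub>C 'b) \<Rightarrow> ('a \<Rightarrow>\<^sub>C 'b) \<Rightarrow> ('a \<Rightarrow>\<^sub>C 'b)"
  is "\<lambda>f g x. f x * g x"
proof -
  fix f g :: "'a \<Rightarrow> 'b"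
  assume f: "f \<in> bcontfun" and g: "g \<in> bcontfun"
  obtain a b where a: "\<And>x. norm (f x) \<le> a" and b: "\<And>x. norm (g x) \<le> b"
    using f g by (auto simp: bcontfun_def bounded_iff)
  have "norm (f x * g x) \<le> a * b" for x
    unfolding norm_mult by (rule mult_mono'[OF a b]) simp_all
  then have "bounded (range (\<lambda>x. f x * g x))"
    by (auto simp: bounded_iff)
  then show "(\<lambda>x. f x * g x) \<in> bcontfun"
    using f g by (auto simp: bcontfun_def intro: continuous_on_mult)
qed

instance
proof
  fix a b c :: "'a \<Rightarrow>\<^sub>C 'b"
  show "a * b * c = a * (b * c)" by transfer (simp add: mult.assoc)
  show "a * b = b * a" by transfer (simp add: mult.commute)
  show "1 * a = a" by transfer simp
  show "(a + b) * c = a * c + b * c" by transfer (simp add: distrib_right)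
  show "(0 :: 'a \<Rightarrow>\<^sub>C 'b) \<noteq> 1" by transfer (simp add: fun_eq_iff)
qed

end

lift_definition cfun_cnj :: "('c::topological_space \<Rightarrow>\<^sub>C complex) \<Rightarrow> ('c \<Rightarrow>\<^sub>C complex)"
  is "\<lambda>f x. cnj (f x)"
  by (auto simp: bcontfun_def bounded_iff intro: continuous_on_cnj)

definition local_homeomorphism :: "('a::topological_space \<Rightarrow> 'b::topological_space) \<Rightarrow> bool" where
  "local_homeomorphism s \<longleftrightarrow>
     (\<forall>x. \<exists>U. open U \<and> x \<in> U \<and> open (s ` U) \<and> (\<exists>g. homeomorphism U (s ` U) s g))"

text \<open>For a surjective local homeomorphism of a compact Hausdorff space the fibres are finite and
  nonempty, and both functions below are continuous, so that the abstraction \<^const>\<open>Bcontfun\<close> is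
  applied inside its domain.\<close>

definition endo :: "('c::topological_space \<Rightarrow> 'c) \<Rightarrow> ('c \<Rightarrow>\<^sub>C complex) \<Rightarrow> ('c \<Rightarrow>\<^sub>C complex)" where
  "endo \<sigma> f = Bcontfun (\<lambda>c. f (\<sigma> c))"

definition transfer_op :: "('c::topological_space \<Rightarrow> 'c) \<Rightarrow> ('c \<Rightarrow>\<^sub>C complex) \<Rightarrow> ('c \<Rightarrow>\<^sub>C complex)" where
  "transfer_op \<sigma> f = Bcontfun (\<lambda>c. (\<Sum>d\<in>\<sigma> -` {c}. f d) / of_nat (card (\<sigma> -` {c})))"


section \<open>Hilbert modules over the algebra of continuous functions\<close>

definition module_norm :: "('x \<Rightarrow> 'x \<Rightarrow> ('c::topological_space \<Rightarrow>\<^sub>C complex)) \<Rightarrow> 'x \<Rightarrow> real" where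
  "module_norm ip x = sqrt (norm (ip x x))"

text \<open>A module is given by its right action and its inner product. The algebra is unital, so the
  complex vector space structure is the action of the constant functions, and additive module maps
  are automatically complex linear.\<close>

locale hilbert_module =
  fixes act :: "'x::ab_group_add \<Rightarrow> ('c::topological_space \<Rightarrow>\<^sub>C complex) \<Rightarrow> 'x"
    and ip :: "'x \<Rightarrow> 'x \<Rightarrow> ('c \<Rightarrow>\<^sub>C complex)"
  assumes act_add_left: "act (x + y) a = act x a + act y a"
    and act_add_right: "act x (a + b) = act x a + act x b"
    and act_mult: "act x (a * b) = act (act x a) b"
    and act_one: "act x 1 = x"
    and ip_add_right: "ip x (y + z) = ip x y + ip x z"
    and ip_act_right: "ip x (act y a) = ip x y * a"
    and ip_cnj: "ip y x = cfun_cnj (ip x y)"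
    and ip_nonneg: "ip x x c \<in> \<real>\<^sub>\<ge>\<^sub>0"
    and ip_definite: "ip x x = 0 \<Longrightarrow> x = 0"
    and complete: "(\<And>e. e > 0 \<Longrightarrow> \<exists>N. \<forall>m\<ge>N. \<forall>n\<ge>N. module_norm ip (s m - s n) < e) \<Longrightarrow>
                     \<exists>x. (\<lambda>n. module_norm ip (s n - x)) \<longlonglongrightarrow> 0"

definition ip_preserving ::
    "('x \<Rightarrow> 'x \<Rightarrow> ('c::topological_space \<Rightarrow>\<^sub>C complex)) \<Rightarrow> ('y \<Rightarrow> 'y \<Rightarrow> ('c \<Rightarrow>\<^sub>C complex))
      \<Rightarrow> ('x \<Rightarrow> 'y) \<Rightarrow> bool" where
  "ip_preserving ip ip' T \<longleftrightarrow> (\<forall>x y. ip' (T x) (T y) = ip x y)"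

definition module_map ::
    "('x::ab_group_add \<Rightarrow> ('c::topological_space \<Rightarrow>\<^sub>C complex) \<Rightarrow> 'x)
      \<Rightarrow> ('y::ab_group_add \<Rightarrow> ('c \<Rightarrow>\<^sub>C complex) \<Rightarrow> 'y) \<Rightarrow> ('x \<Rightarrow> 'y) \<Rightarrow> bool" where
  "module_map act act' T \<longleftrightarrow>
     (\<forall>x y. T (x + y) = T x + T y) \<and> (\<forall>x a. T (act x a) = act' (T x) a)"

definition hilbert_module_iso where
  "hilbert_module_iso act ip act' ip' T \<longleftrightarrow>
     bij T \<and> module_map act act' T \<and> ip_preserving ip ip' T"

definition closed_submodule ::
    "('x::ab_group_add \<Rightarrow> ('c::topological_space \<Rightarrow>\<^sub>C complex) \<Rightarrow> 'x)
      \<Rightarrow> ('x \<Rightarrow> 'x \<Rightarrow> ('c \<Rightarrow>\<^sub>C complex)) \<Rightarrow> 'x set \<Rightarrow> bool" where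
  "closed_submodule act ip Z \<longleftrightarrow>
     0 \<in> Z \<and> (\<forall>x\<in>Z. \<forall>y\<in>Z. x + y \<in> Z) \<and> (\<forall>x\<in>Z. \<forall>a. act x a \<in> Z) \<and>
     (\<forall>s x. (\<forall>n::nat. s n \<in> Z) \<and> (\<lambda>n. module_norm ip (s n - x)) \<longlonglongrightarrow> 0 \<longrightarrow> x \<in> Z)"

definition generated_submodule where
  "generated_submodule act ip B = \<Inter>{Z. closed_submodule act ip Z \<and> B \<subseteq> Z}"

text \<open>The closed submodule \<open>Z\<close> is itself a Hilbert module, with the restricted structure. The frame
  is a family with index set \<open>J\<close>, and the sum converges unconditionally in the supremum norm; as its
  terms are positive, this is the same as convergence for any enumeration of \<open>J\<close>.\<close>

definition parseval_frame ::
    "('x::ab_group_add \<Rightarrow> ('c::topological_space \<Rightarrow>\<^sub>C complex) \<Rightarrow> 'x)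
      \<Rightarrow> ('x \<Rightarrow> 'x \<Rightarrow> ('c \<Rightarrow>\<^sub>C complex)) \<Rightarrow> 'x set \<Rightarrow> ('j \<Rightarrow> 'x) \<Rightarrow> 'j set \<Rightarrow> bool" where
  "parseval_frame act ip Z x J \<longleftrightarrow>
     closed_submodule act ip Z \<and> countable J \<and> x ` J \<subseteq> Z \<and>
     (\<forall>z\<in>Z. ((\<lambda>j. ip z (x j) * ip (x j) z) has_sum ip z z) J)"

definition orthonormal_basis ::
    "('x::ab_group_add \<Rightarrow> ('c::topological_space \<Rightarrow>\<^sub>C complex) \<Rightarrow> 'x)
      \<Rightarrow> ('x \<Rightarrow> 'x \<Rightarrow> ('c \<Rightarrow>\<^sub>C complex)) \<Rightarrow> 'x set \<Rightarrow> ('j \<Rightarrow> 'x) \<Rightarrow> 'j set \<Rightarrow> bool" where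
  "orthonormal_basis act ip Z x J \<longleftrightarrow>
     countable J \<and> generated_submodule act ip (x ` J) = Z \<and>
     (\<forall>j\<in>J. \<forall>k\<in>J. ip (x j) (x k) = (if j = k then 1 else 0))"


section \<open>Twisted modules and the direct limit\<close>

text \<open>With \<open>a\<close> the endomorphism and \<open>L\<close> the transfer operator, these are the action and inner
  product of the module \<open>X\<^sub>L\<close>.\<close>

definition twist_act :: "('a \<Rightarrow> 'a) \<Rightarrow> ('x \<Rightarrow> 'a \<Rightarrow> 'x) \<Rightarrow> 'x \<Rightarrow> 'a \<Rightarrow> 'x" where
  "twist_act a act x f = act x (a f)"

definition twist_ip :: "('a \<Rightarrow> 'a) \<Rightarrow> ('x \<Rightarrow> 'x \<Rightarrow> 'a) \<Rightarrow> 'x \<Rightarrow> 'x \<Rightarrow> 'a" where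
  "twist_ip L ip x y = L (ip x y)"

text \<open>The module \<open>M\<^sub>L\<close>. The tensor power of order \<open>k\<close> is the same construction applied to the
  \<open>k\<close>-th iterates of \<open>a\<close> and \<open>L\<close>, with \<open>n\<^sub>1 \<otimes> \<dots> \<otimes> n\<^sub>k\<close> identified with the product of the
  functions \<open>a\<^bsup>l-1\<^esup> n\<^sub>l\<close>.\<close>

definition corr_act ::
    "(('c::topological_space \<Rightarrow>\<^sub>C complex) \<Rightarrow> ('c \<Rightarrow>\<^sub>C complex))
      \<Rightarrow> ('c \<Rightarrow>\<^sub>C complex) \<Rightarrow> ('c \<Rightarrow>\<^sub>C complex) \<Rightarrow> ('c \<Rightarrow>\<^sub>C complex)" where
  "corr_act a n f = n * a f"

definition corr_ip ::
    "(('c::topological_space \<Rightarrow>\<^sub>C complex) \<Rightarrow> ('c \<Rightarrow>\<^sub>C complex))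
      \<Rightarrow> ('c \<Rightarrow>\<^sub>C complex) \<Rightarrow> ('c \<Rightarrow>\<^sub>C complex) \<Rightarrow> ('c \<Rightarrow>\<^sub>C complex)" where
  "corr_ip L n n' = L (cfun_cnj n * n')"

text \<open>\<open>Y\<close> with canonical maps \<open>\<iota> k\<close> is the direct limit of the inner-product preserving maps
  \<open>T k\<close> from the \<open>k\<close>-th to the \<open>Suc k\<close>-th module: the completion of the disjoint union of the modules
  in which \<open>n\<close> at level \<open>k\<close> is identified with \<open>T k n\<close> at level \<open>Suc k\<close>. That is, \<open>Y\<close> is complete,
  the \<open>\<iota> k\<close> embed the modules compatibly, and the union of their ranges is dense. The limit is
  determined up to unique isomorphism; since it depends on the system, it is specified here as a
  predicate, not as a type.\<close>

definition hilbert_direct_limit ::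
    "(nat \<Rightarrow> 'm::ab_group_add \<Rightarrow> ('c::topological_space \<Rightarrow>\<^sub>C complex) \<Rightarrow> 'm)
      \<Rightarrow> (nat \<Rightarrow> 'm \<Rightarrow> 'm \<Rightarrow> ('c \<Rightarrow>\<^sub>C complex)) \<Rightarrow> (nat \<Rightarrow> 'm \<Rightarrow> 'm)
      \<Rightarrow> ('y::ab_group_add \<Rightarrow> ('c \<Rightarrow>\<^sub>C complex) \<Rightarrow> 'y) \<Rightarrow> ('y \<Rightarrow> 'y \<Rightarrow> ('c \<Rightarrow>\<^sub>C complex))
      \<Rightarrow> (nat \<Rightarrow> 'm \<Rightarrow> 'y) \<Rightarrow> bool" where
  "hilbert_direct_limit actM ipM T actY ipY \<iota> \<longleftrightarrow>
     hilbert_module actY ipY \<and>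
     (\<forall>k. module_map (actM k) actY (\<iota> k) \<and> ip_preserving (ipM k) ipY (\<iota> k)) \<and>
     (\<forall>k n. \<iota> (Suc k) (T k n) = \<iota> k n) \<and>
     (\<forall>y. \<forall>e>0. \<exists>k n. module_norm ipY (y - \<iota> k n) < e)"


section \<open>The family attached to a frame\<close>

text \<open>The index \<^term>\<open>None\<close> stands for the extra element \<open>\<phi>\<close>; the list in \<^term>\<open>Some js\<close> is the
  tuple \<open>(j\<^sub>1, \<dots>, j\<^sub>k)\<close>, whose entry \<open>j\<^sub>l\<close> is \<open>js ! (l - 1)\<close>.\<close>

definition wavelet_index :: "nat set \<Rightarrow> nat list option set" where
  "wavelet_index J = insert None (Some ` {js. js \<noteq> [] \<and> set js \<subseteq> J \<and> hd js > 0})"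

definition wavelet ::
    "(('c::topological_space \<Rightarrow>\<^sub>C complex) \<Rightarrow> ('c \<Rightarrow>\<^sub>C complex))
      \<Rightarrow> ('x \<Rightarrow> ('c \<Rightarrow>\<^sub>C complex) \<Rightarrow> 'x) \<Rightarrow> ('x \<Rightarrow> 'x) \<Rightarrow> 'x \<Rightarrow> (nat \<Rightarrow> ('c \<Rightarrow>\<^sub>C complex))
      \<Rightarrow> nat list option \<Rightarrow> 'x" where
  "wavelet a act D \<phi> m i =
     (case i of
        None \<Rightarrow> \<phi>
      | Some js \<Rightarrow>
          (inv D ^^ length js) (act \<phi> (\<Prod>l = 1..length js. (a ^^ (l - 1)) (m (js ! (l - 1))))))"

end

theory Submission
  imports Defs
begin

text \<open>The identity \<open>\<langle>x, m\<^sub>j \<alpha>(n)\<rangle> = \<langle>L(m\<^sub>j\<^sup>* x), n\<rangle>\<close>, in which the two inner products belong to the tensor powers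
  of order \<open>k + 1\<close> and \<open>k\<close>, shows by induction that the elementary tensors of length \<open>k\<close> in the frame
  elements form a Parseval frame of the \<open>k\<close>-th tensor power. Inside the direct limit, tensoring with
  \<open>m\<^sub>0\<close> on the left does nothing, so deleting leading zeros identifies that frame with the part of the
  wavelet family of level at most \<open>k\<close>. The Parseval identity therefore holds on the union of the
  tensor powers. It passes to the closure, because the defect
  \<open>\<langle>y, y\<rangle> - \<Sum>\<^sub>i \<langle>y, w\<^sub>i\<rangle>\<langle>w\<^sub>i, y\<rangle>\<close> of a finite partial sum is a positive quadratic form in \<open>y\<close> that obeys
  the parallelogram law. Finally \<open>D \<circ> Q = Q \<circ> R\<close> gives \<open>Q(\<iota>\<^sup>k(n)) = D\<^sup>-\<^sup>k(\<phi> \<cdot> n)\<close>, so the isometry \<open>Q\<close> carries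
  the family to the displayed one.\<close>

section \<open>The algebra of continuous functions\<close>

lemma apply_bcontfun_ring [simp]:
  fixes f g :: "'c::topological_space \<Rightarrow>\<^sub>C 'b::real_normed_field"
  shows "apply_bcontfun (1 :: 'c \<Rightarrow>\<^sub>C 'b) c = 1"
    and "(f * g) c = f c * g c"
  by (simp_all add: one_bcontfun.rep_eq times_bcontfun.rep_eq)

lemma apply_bcontfun_sum:
  fixes f :: "'i \<Rightarrow> ('c::topological_space \<Rightarrow>\<^sub>C 'b::real_normed_vector)"
  shows "apply_bcontfun (sum f A) c = (\<Sum>i\<in>A. apply_bcontfun (f i) c)"
  by (induction A rule: infinite_finite_induct) simp_all

lemma apply_cfun_cnj [simp]: "cfun_cnj f c = cnj (f c)"
  for f :: "'c::topological_space \<Rightarrow>\<^sub>C complex"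
  by (simp add: cfun_cnj.rep_eq)

lemma cfun_cnj_simps [simp]:
  "cfun_cnj (cfun_cnj f) = f"
  "cfun_cnj (f + g) = cfun_cnj f + cfun_cnj g"
  "cfun_cnj (f * g) = cfun_cnj f * cfun_cnj g"
  "cfun_cnj 1 = 1"
  "cfun_cnj (- f) = - cfun_cnj f"
  "cfun_cnj 0 = 0"
  "cfun_cnj (r *\<^sub>R f) = r *\<^sub>R cfun_cnj f"
  by (rule bcontfun_eqI; simp)+

lemma bounded_linear_apply_bcontfun:
  "bounded_linear (\<lambda>f :: 'c::topological_space \<Rightarrow>\<^sub>C 'b::real_normed_vector. f c)"
  by (rule bounded_linear_intro[where K = 1]) (simp_all add: norm_bounded)

section \<open>Positive functions and unconditional sums of them\<close>

definition nonneg_cfun :: "('c::topological_space \<Rightarrow>\<^sub>C complex) \<Rightarrow> bool" where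
  "nonneg_cfun f \<longleftrightarrow> (\<forall>c. f c \<in> \<real>\<^sub>\<ge>\<^sub>0)"

lemma nonneg_cfunI: "(\<And>c. 0 \<le> Re (f c) \<and> Im (f c) = 0) \<Longrightarrow> nonneg_cfun f"
  for f :: "'c::topological_space \<Rightarrow>\<^sub>C complex"
  by (simp add: nonneg_cfun_def complex_nonneg_Reals_iff)

lemma nonneg_cfunD: "nonneg_cfun f \<Longrightarrow> 0 \<le> Re (f c) \<and> Im (f c) = 0"
  for f :: "'c::topological_space \<Rightarrow>\<^sub>C complex"
  by (simp add: nonneg_cfun_def complex_nonneg_Reals_iff)

lemma nonneg_cfun_add: "nonneg_cfun f \<Longrightarrow> nonneg_cfun g \<Longrightarrow> nonneg_cfun (f + g)"
  by (simp add: nonneg_cfun_def nonneg_Reals_add_I)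

lemma nonneg_cfun_sum: "(\<And>i. i \<in> A \<Longrightarrow> nonneg_cfun (f i)) \<Longrightarrow> nonneg_cfun (sum f A)"
  by (induction A rule: infinite_finite_induct) (auto simp: nonneg_cfun_add, auto simp: nonneg_cfun_def)

lemma nonneg_cfun_cnj_mult: "nonneg_cfun (cfun_cnj f * f)"
  by (rule nonneg_cfunI) simp

text \<open>A positive value is its own modulus, so the pointwise order passes to the supremum
  norm.\<close>

lemma nonneg_cfun_norm_mono:
  fixes f g :: "'c::topological_space \<Rightarrow>\<^sub>C complex"
  assumes "nonneg_cfun f" "nonneg_cfun (g - f)"
  shows "norm f \<le> norm g"
proof (rule norm_bound)
  fix c
  have "norm (f c) = Re (f c)"
    using nonneg_cfunD[OF assms(1), of c] by (simp add: cmod_eq_Re)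
  also have "\<dots> \<le> Re (g c)"
    using nonneg_cfunD[OF assms(2), of c] by simp
  also have "\<dots> \<le> norm g"
    by (meson complex_Re_le_cmod norm_bounded order_trans)
  finally show "norm (f c) \<le> norm g" .
qed

text \<open>Remainders shrink as the finite set grows, so one good finite set controls all larger
  ones. Convergence thus splits into a Bessel inequality and an approximation by single finite
  sets.\<close>

lemma has_sum_nonneg_cfun_iff:
  fixes f :: "'j \<Rightarrow> ('c::topological_space \<Rightarrow>\<^sub>C complex)"
  assumes "\<And>i. i \<in> A \<Longrightarrow> nonneg_cfun (f i)"
  shows "(f has_sum S) A \<longleftrightarrow>
    (\<forall>F. finite F \<and> F \<subseteq> A \<longrightarrow> nonneg_cfun (S - sum f F)) \<and>
    (\<forall>e>0. \<exists>F. finite F \<and> F \<subseteq> A \<and> norm (S - sum f F) \<le> e)"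
proof (intro iffI conjI allI impI)
  fix F assume S: "(f has_sum S) A" and F: "finite F \<and> F \<subseteq> A"
  show "nonneg_cfun (S - sum f F)"
  proof (rule nonneg_cfunI)
    fix c
    \<comment> \<open>Comparing a finite sum with the total needs an ordered target, hence real
      parts at a fixed point; the imaginary parts of all terms vanish.\<close>
    have Re: "((\<lambda>i. Re (f i c)) has_sum Re (S c)) A"
      and Im: "((\<lambda>i. Im (f i c)) has_sum Im (S c)) A"
      using S bounded_linear_compose[OF bounded_linear_Re bounded_linear_apply_bcontfun]
        bounded_linear_compose[OF bounded_linear_Im bounded_linear_apply_bcontfun]
      by (auto dest: has_sum_bounded_linear)
    have "(\<Sum>i\<in>F. Re (f i c)) \<le> Re (S c)"
      using Re F assms by (intro finite_sum_le_has_sum) (auto dest: nonneg_cfunD)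
    moreover have "((\<lambda>i. Im (f i c)) has_sum 0) A"
      using assms by (auto intro!: has_sum_0 dest: nonneg_cfunD)
    then have "Im (S c) = 0"
      using Im has_sum_unique by blast
    moreover have "(\<Sum>i\<in>F. Im (f i c)) = 0"
      using assms F by (intro sum.neutral) (auto dest: nonneg_cfunD)
    ultimately show "0 \<le> Re ((S - sum f F) c) \<and> Im ((S - sum f F) c) = 0"
      by (simp add: apply_bcontfun_sum)
  qed
next
  fix e :: real assume "(f has_sum S) A" "e > 0"
  then show "\<exists>F. finite F \<and> F \<subseteq> A \<and> norm (S - sum f F) \<le> e"
    using has_sum_finite_approximation by (metis dist_commute dist_norm)
next
  assume R: "(\<forall>F. finite F \<and> F \<subseteq> A \<longrightarrow> nonneg_cfun (S - sum f F)) \<and>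
    (\<forall>e>0. \<exists>F. finite F \<and> F \<subseteq> A \<and> norm (S - sum f F) \<le> e)"
  show "(f has_sum S) A"
    unfolding has_sum_def tendsto_iff eventually_finite_subsets_at_top
  proof (intro allI impI)
    fix e :: real assume "e > 0"
    then obtain F where F: "finite F" "F \<subseteq> A" "norm (S - sum f F) \<le> e / 2"
      using R by (meson half_gt_zero)
    have "dist (sum f G) S < e" if G: "finite G \<and> F \<subseteq> G \<and> G \<subseteq> A" for G
    proof -
      have "(S - sum f F) - (S - sum f G) = sum f (G - F)"
        using G by (simp add: sum_diff)
      then have "nonneg_cfun ((S - sum f F) - (S - sum f G))"
        using G assms by (auto intro: nonneg_cfun_sum)
      then have "norm (S - sum f G) \<le> norm (S - sum f F)"
        using R G by (intro nonneg_cfun_norm_mono) auto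
      then show ?thesis
        using F(3) \<open>e > 0\<close> by (simp add: dist_norm norm_minus_commute)
    qed
    then show "\<exists>X. finite X \<and> X \<subseteq> A \<and>
        (\<forall>Y. finite Y \<and> X \<subseteq> Y \<and> Y \<subseteq> A \<longrightarrow> dist (sum f Y) S < e)"
      using F by blast
  qed
qed

text \<open>Iterated sums do not give summability over pairs in general. Positivity makes both
  halves of \<open>has_sum_nonneg_cfun_iff\<close> follow from those of the inner and outer
  sums.\<close>

lemma has_sum_Sigma_nonneg_cfun:
  fixes f :: "'i \<times> 'j \<Rightarrow> ('c::topological_space \<Rightarrow>\<^sub>C complex)"
  assumes nonneg: "\<And>x y. x \<in> A \<Longrightarrow> y \<in> B x \<Longrightarrow> nonneg_cfun (f (x, y))"
    and inner: "\<And>x. x \<in> A \<Longrightarrow> ((\<lambda>y. f (x, y)) has_sum g x) (B x)"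
    and outer: "(g has_sum S) A"
  shows "(f has_sum S) (Sigma A B)"
proof -
  have nonneg': "\<And>p. p \<in> Sigma A B \<Longrightarrow> nonneg_cfun (f p)"
    using nonneg by auto
  have inner1: "nonneg_cfun (g x - (\<Sum>y\<in>F. f (x, y)))" if "x \<in> A" "finite F" "F \<subseteq> B x" for x F
    using inner[OF that(1)] that has_sum_nonneg_cfun_iff[of "B x" "\<lambda>y. f (x, y)"] nonneg by auto
  have inner2: "\<exists>F. finite F \<and> F \<subseteq> B x \<and> norm (g x - (\<Sum>y\<in>F. f (x, y))) \<le> e"
    if "x \<in> A" "e > 0" for x e
    using inner[OF that(1)] that has_sum_nonneg_cfun_iff[of "B x" "\<lambda>y. f (x, y)"] nonneg by auto
  have g_nonneg: "nonneg_cfun (g x)" if "x \<in> A" for x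
    using inner1[OF that, of "{}"] by simp
  note outer' = iffD1[OF has_sum_nonneg_cfun_iff[OF g_nonneg] outer]
  show ?thesis
  proof (rule iffD2[OF has_sum_nonneg_cfun_iff[OF nonneg']]; (intro conjI allI impI)?)
    fix F assume F: "finite F \<and> F \<subseteq> Sigma A B"
    \<comment> \<open>\<open>C x\<close> is the slice of \<open>F\<close> over \<open>x\<close>. The
      remainder of \<open>F\<close> splits into an outer remainder and the inner remainders of the
      slices, all positive.\<close>
    define C where "C x = {y. (x, y) \<in> F}" for x
    have FC: "F = Sigma (fst ` F) C"
      by (force simp: C_def)
    have C: "finite (C x)" for x
      using F finite_subset[of "C x" "snd ` F"] by (force simp: C_def)
    have A: "fst ` F \<subseteq> A" "\<And>x. C x \<subseteq> B x"
      using F by (auto simp: C_def)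
    have "sum f F = (\<Sum>x\<in>fst ` F. \<Sum>y\<in>C x. f (x, y))"
      using F C by (subst FC, subst sum.Sigma) auto
    then have eq: "S - sum f F =
        (S - sum g (fst ` F)) + (\<Sum>x\<in>fst ` F. g x - (\<Sum>y\<in>C x. f (x, y)))"
      by (simp add: sum_subtractf)
    show "nonneg_cfun (S - sum f F)"
      unfolding eq
    proof (rule nonneg_cfun_add)
      show "nonneg_cfun (S - sum g (fst ` F))"
        using outer' A F by simp
      show "nonneg_cfun (\<Sum>x\<in>fst ` F. g x - (\<Sum>y\<in>C x. f (x, y)))"
        using A C by (intro nonneg_cfun_sum inner1) auto
    qed
  next
    fix e :: real assume "e > 0"
    then obtain F where F: "finite F" "F \<subseteq> A" "norm (S - sum g F) \<le> e / 2"
      using outer' by (meson half_gt_zero)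
    \<comment> \<open>Half of \<open>e\<close> is left for the \<open>card F\<close> inner sums; the
      \<open>+ 1\<close> keeps the divisor nonzero for empty \<open>F\<close>.\<close>
    define d where "d = e / 2 / (card F + 1)"
    have "d > 0"
      using \<open>e > 0\<close> by (simp add: d_def)
    then have "\<forall>x\<in>F. \<exists>G. finite G \<and> G \<subseteq> B x \<and> norm (g x - (\<Sum>y\<in>G. f (x, y))) \<le> d"
      using inner2 F by blast
    then obtain C where C: "\<And>x. x \<in> F \<Longrightarrow>
        finite (C x) \<and> C x \<subseteq> B x \<and> norm (g x - (\<Sum>y\<in>C x. f (x, y))) \<le> d"
      by metis
    have "sum f (Sigma F C) = (\<Sum>x\<in>F. \<Sum>y\<in>C x. f (x, y))"
      using F C by (subst sum.Sigma) auto
    then have eq: "S - sum f (Sigma F C) = (S - sum g F) + (\<Sum>x\<in>F. g x - (\<Sum>y\<in>C x. f (x, y)))"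
      by (simp add: sum_subtractf)
    have "norm (\<Sum>x\<in>F. g x - (\<Sum>y\<in>C x. f (x, y))) \<le> (\<Sum>x\<in>F. d)"
      using C by (intro sum_norm_le) auto
    moreover have "(\<Sum>x\<in>F. d) \<le> e / 2"
      using \<open>e > 0\<close> by (simp add: d_def field_simps)
    ultimately have "norm (S - sum g F) + norm (\<Sum>x\<in>F. g x - (\<Sum>y\<in>C x. f (x, y))) \<le> e"
      using F(3) by linarith
    then have "norm (S - sum f (Sigma F C)) \<le> e"
      unfolding eq by (rule norm_triangle_le)
    then show "\<exists>G. finite G \<and> G \<subseteq> Sigma A B \<and> norm (S - sum f G) \<le> e"
      using F C by (intro exI[of _ "Sigma F C"]) auto
  qed
qed

section \<open>The transfer operator\<close>

lemma local_homeomorphismD: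
  assumes "local_homeomorphism s"
  obtains U g where "open U" "x \<in> U" "open (s ` U)" "homeomorphism U (s ` U) s g"
  using assms unfolding local_homeomorphism_def by blast

lemma continuous_on_local_homeomorphism:
  fixes s :: "'c::t2_space \<Rightarrow> 'd::topological_space"
  assumes "local_homeomorphism s"
  shows "continuous_on UNIV s"
proof (intro continuous_at_imp_continuous_on ballI)
  fix x
  obtain U g where "open U" "x \<in> U" "homeomorphism U (s ` U) s g"
    by (rule local_homeomorphismD[OF assms])
  then show "isCont s x"
    using continuous_on_eq_continuous_at homeomorphism_cont1 by blast
qed

text \<open>The fibre is compact and covered by open sets on which \<open>s\<close> is injective.
  Each set \<open>U x\<close> with \<open>x\<close> in the fibre meets it only in \<open>x\<close>,
  so the centres of a finite subcover exhaust it.\<close>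

lemma finite_fibre_local_homeomorphism:
  fixes s :: "'c::t2_space \<Rightarrow> 'd::t2_space"
  assumes "compact (UNIV :: 'c set)" "local_homeomorphism s"
  shows "finite (s -` {c})"
proof -
  have cont: "continuous_on UNIV s"
    by (rule continuous_on_local_homeomorphism) fact
  have "closed (s -` {c})"
    by (rule closed_vimage[OF closed_singleton cont])
  then have comp: "compact (s -` {c})"
    using compact_Int_closed[OF assms(1)] by fastforce
  have "\<exists>U. open U \<and> x \<in> U \<and> inj_on s U" for x
  proof -
    obtain U g where U: "open U" "x \<in> U" "homeomorphism U (s ` U) s g"
      by (rule local_homeomorphismD[OF assms(2)])
    then have "inj_on s U"
      by (intro inj_on_inverseI[of _ g]) (rule homeomorphism_apply1)
    then show "\<exists>U. open U \<and> x \<in> U \<and> inj_on s U"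
      using U by blast
  qed
  then obtain U where U: "\<And>x. open (U x) \<and> x \<in> U x \<and> inj_on s (U x)"
    by metis
  obtain D where D: "D \<subseteq> s -` {c}" "finite D" "s -` {c} \<subseteq> (\<Union>x\<in>D. U x)"
  proof (rule compactE_image[OF comp, of "s -` {c}" U])
    show "open (U x)" for x
      using U by blast
    show "s -` {c} \<subseteq> (\<Union>x\<in>s -` {c}. U x)"
      using U by blast
  qed
  have "s -` {c} \<subseteq> D"
  proof
    fix y assume y: "y \<in> s -` {c}"
    then obtain x where "x \<in> D" "y \<in> U x"
      using D by blast
    then have "y = x"
      using U[of x] y D(1) by (intro inj_onD[of s "U x"]) auto
    then show "y \<in> D"
      using \<open>x \<in> D\<close> by simp
  qed
  then show ?thesis
    using D(2) finite_subset by blast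
qed

text \<open>Near \<open>c\<close> the fibre is the image of the fibre over \<open>c\<close> under finitely many local inverses with
  distinct values.\<close>

lemma continuous_on_fibre_sum:
  fixes s :: "'c::t2_space \<Rightarrow> 'd::t2_space" and f :: "'c \<Rightarrow> 'b::{topological_comm_monoid_add, t2_space}"
  assumes comp: "compact (UNIV :: 'c set)" and loc: "local_homeomorphism s"
    and f: "continuous_on UNIV f"
  shows "continuous_on UNIV (\<lambda>c. \<Sum>d\<in>s -` {c}. f d)"
proof (intro continuous_at_imp_continuous_on ballI)
  fix c
  define F where "F = s -` {c}"
  have finF: "finite F"
    unfolding F_def by (rule finite_fibre_local_homeomorphism[OF comp loc])
  have "\<exists>U g. open U \<and> x \<in> U \<and> open (s ` U) \<and> homeomorphism U (s ` U) s g" for x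
    using loc unfolding local_homeomorphism_def by blast
  then obtain U g where U: "\<And>x. open (U x)" "\<And>x. x \<in> U x" "\<And>x. open (s ` U x)"
    and g: "\<And>x. homeomorphism (U x) (s ` U x) s (g x)"
    by metis
  have gc: "g d c = d" if "d \<in> F" for d
    using homeomorphism_apply1[OF g U(2), of d] that by (simp add: F_def)
  have cU: "c \<in> s ` U d" if "d \<in> F" for d
    using U(2)[of d] that by (auto simp: F_def)
  have lim: "(g d \<longlongrightarrow> d) (nhds c)" if "d \<in> F" for d
  proof -
    have "isCont (g d) c"
      using homeomorphism_cont2[OF g, of d] U(3)[of d] cU[OF that]
      by (metis continuous_on_eq_continuous_at)
    then show ?thesis
      using gc[OF that] by (metis isCont_def tendsto_at_iff_tendsto_nhds)
  qed
  have "\<forall>\<^sub>F b in nhds c. \<forall>d\<in>F. \<forall>d'\<in>F. d \<noteq> d' \<longrightarrow> g d b \<noteq> g d' b"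
  proof (intro eventually_ball_finite[OF finF] ballI)
    fix d d' assume d: "d \<in> F" "d' \<in> F"
    show "\<forall>\<^sub>F b in nhds c. d \<noteq> d' \<longrightarrow> g d b \<noteq> g d' b"
    proof (cases "d = d'")
      case False
      obtain V W where VW: "open V" "open W" "d \<in> V" "d' \<in> W" "V \<inter> W = {}"
        using hausdorff[OF False] by auto
      have "\<forall>\<^sub>F b in nhds c. g d b \<in> V" "\<forall>\<^sub>F b in nhds c. g d' b \<in> W"
        using VW lim d by (auto intro: topological_tendstoD)
      then show ?thesis
        by eventually_elim (use VW in auto)
    qed simp
  qed
  moreover have "\<forall>\<^sub>F b in nhds c. \<forall>d\<in>F. b \<in> s ` U d"
    using U(3) cU by (intro eventually_ball_finite[OF finF] ballI eventually_nhds_in_open) auto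
  \<comment> \<open>No further preimages appear near \<open>c\<close>: the complement of the chosen
    neighbourhoods is compact, so its image is closed, and it misses \<open>c\<close>.\<close>
  moreover have "\<forall>\<^sub>F b in nhds c. b \<in> - s ` (- (\<Union>d\<in>F. U d))"
  proof (rule eventually_nhds_in_open)
    have "closed (- (\<Union>d\<in>F. U d))"
      using U(1) by auto
    then have "compact (- (\<Union>d\<in>F. U d))"
      using comp compact_Int_closed[of UNIV] by fastforce
    then have "compact (s ` (- (\<Union>d\<in>F. U d)))"
      using continuous_on_local_homeomorphism[OF loc] compact_continuous_image continuous_on_subset
      by (metis top_greatest)
    then show "open (- s ` (- (\<Union>d\<in>F. U d)))"
      by (simp add: compact_imp_closed open_Compl)
    show "c \<in> - s ` (- (\<Union>d\<in>F. U d))"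
      using U(2) by (auto simp: F_def)
  qed
  ultimately have "\<forall>\<^sub>F b in nhds c. (\<Sum>d\<in>F. f (g d b)) = (\<Sum>d\<in>s -` {b}. f d)"
  proof eventually_elim
    case (elim b)
    have "s -` {b} = (\<lambda>d. g d b) ` F"
    proof (intro equalityI subsetI)
      fix e assume e: "e \<in> s -` {b}"
      then obtain d where "d \<in> F" "e \<in> U d"
        using elim by blast
      then show "e \<in> (\<lambda>d. g d b) ` F"
        using homeomorphism_apply1[OF g, of e d] e by force
    next
      fix e assume "e \<in> (\<lambda>d. g d b) ` F"
      then show "e \<in> s -` {b}"
        using homeomorphism_apply2[OF g] elim by force
    qed
    moreover have "inj_on (\<lambda>d. g d b) F"
      using elim by (auto simp: inj_on_def)
    ultimately show ?case
      by (simp add: sum.reindex)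
  qed
  moreover have "((\<lambda>b. \<Sum>d\<in>F. f (g d b)) \<longlongrightarrow> (\<Sum>d\<in>F. f d)) (nhds c)"
  proof (intro tendsto_sum)
    fix d assume "d \<in> F"
    moreover have "(f \<longlongrightarrow> f d) (nhds d)"
      using f by (metis UNIV_I continuous_on_eq_continuous_at isCont_def open_UNIV tendsto_at_iff_tendsto_nhds)
    ultimately show "((\<lambda>b. f (g d b)) \<longlongrightarrow> f d) (nhds c)"
      using lim by (metis filterlim_compose)
  qed
  ultimately have "((\<lambda>b. \<Sum>d\<in>s -` {b}. f d) \<longlongrightarrow> (\<Sum>d\<in>F. f d)) (nhds c)"
    by (simp add: filterlim_cong)
  then show "isCont (\<lambda>c. \<Sum>d\<in>s -` {c}. f d) c"
    unfolding isCont_def F_def by (rule iffD2[OF tendsto_at_iff_tendsto_nhds])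
qed

section \<open>Algebraic properties of the endomorphism and the transfer operator\<close>

lemma Bcontfun_inverse_compact:
  fixes f :: "'c::topological_space \<Rightarrow> 'b::metric_space"
  assumes "compact (UNIV :: 'c set)" "continuous_on UNIV f"
  shows "apply_bcontfun (Bcontfun f) = f"
  using assms by (intro Bcontfun_inverse) (auto simp: bcontfun_def compact_imp_bounded compact_continuous_image)

lemma apply_endo:
  fixes \<sigma> :: "'c::t2_space \<Rightarrow> 'c"
  assumes "compact (UNIV :: 'c set)" "local_homeomorphism \<sigma>"
  shows "endo \<sigma> f c = f (\<sigma> c)"
  unfolding endo_def using continuous_on_local_homeomorphism[OF assms(2)]
  by (subst Bcontfun_inverse_compact[OF assms(1)]) 
    (auto intro: continuous_on_compose2[OF continuous_on_apply_bcontfun])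

text \<open>The cardinality of a fibre is the fibre sum of the constant 1, so the quotient is
  continuous; surjectivity keeps the denominator nonzero.\<close>

lemma apply_transfer_op:
  fixes \<sigma> :: "'c::t2_space \<Rightarrow> 'c"
  assumes comp: "compact (UNIV :: 'c set)" and loc: "local_homeomorphism \<sigma>" and "surj \<sigma>"
  shows "transfer_op \<sigma> f c = (\<Sum>d\<in>\<sigma> -` {c}. f d) / of_nat (card (\<sigma> -` {c}))"
proof -
  have nz: "(of_nat (card (\<sigma> -` {c})) :: complex) \<noteq> 0" for c
  proof -
    have "\<sigma> -` {c} \<noteq> {}"
      using surjD[OF \<open>surj \<sigma>\<close>, of c] by auto
    then show ?thesis
      using finite_fibre_local_homeomorphism[OF comp loc] by simp
  qed
  have "continuous_on UNIV (\<lambda>c. (\<Sum>d\<in>\<sigma> -` {c}. f d) / (\<Sum>d\<in>\<sigma> -` {c}. (1 :: complex)))"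
    using nz by (intro continuous_on_divide continuous_on_fibre_sum[OF comp loc]) auto
  then show ?thesis
    unfolding transfer_op_def by (subst Bcontfun_inverse_compact[OF comp]) auto
qed

lemma bounded_linear_transfer_op:
  fixes \<sigma> :: "'c::t2_space \<Rightarrow> 'c"
  assumes "compact (UNIV :: 'c set)" "local_homeomorphism \<sigma>" "surj \<sigma>"
  shows "bounded_linear (transfer_op \<sigma>)"
proof (rule bounded_linear_intro[where K = 1])
  fix f g :: "'c \<Rightarrow>\<^sub>C complex" and r :: real
  note [simp] = apply_transfer_op[OF assms]
  show "transfer_op \<sigma> (f + g) = transfer_op \<sigma> f + transfer_op \<sigma> g"
    by (rule bcontfun_eqI) (simp add: sum.distrib add_divide_distrib)
  show "transfer_op \<sigma> (r *\<^sub>R f) = r *\<^sub>R transfer_op \<sigma> f"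
    by (rule bcontfun_eqI) (simp add: scaleR_conv_of_real sum_distrib_left[symmetric])
  show "norm (transfer_op \<sigma> f) \<le> norm f * 1"
  proof (rule norm_bound)
    fix c
    have "norm (\<Sum>d\<in>\<sigma> -` {c}. f d) \<le> (\<Sum>d\<in>\<sigma> -` {c}. norm f)"
      by (intro sum_norm_le norm_bounded)
    then show "norm (transfer_op \<sigma> f c) \<le> norm f * 1"
      \<comment> \<open>With cardinality 0 the quotient is 0 by the convention for division, and the
        bound still holds.\<close>
      by (cases "card (\<sigma> -` {c}) = 0") (auto simp: norm_divide divide_simps mult.commute)
  qed
qed

text \<open>On the fibre over \<open>c\<close> the function \<open>endo \<sigma> g\<close> is
  constantly \<open>g c\<close> and factors out of the mean.\<close>

lemma transfer_op_mult_endo: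
  fixes \<sigma> :: "'c::t2_space \<Rightarrow> 'c"
  assumes "compact (UNIV :: 'c set)" "local_homeomorphism \<sigma>" "surj \<sigma>"
  shows "transfer_op \<sigma> (f * endo \<sigma> g) = transfer_op \<sigma> f * g"
  by (rule bcontfun_eqI)
    (simp add: apply_transfer_op[OF assms] apply_endo[OF assms(1,2)] sum_distrib_right[symmetric])

lemma transfer_op_cnj:
  fixes \<sigma> :: "'c::t2_space \<Rightarrow> 'c"
  assumes "compact (UNIV :: 'c set)" "local_homeomorphism \<sigma>" "surj \<sigma>"
  shows "transfer_op \<sigma> (cfun_cnj f) = cfun_cnj (transfer_op \<sigma> f)"
  by (rule bcontfun_eqI) (simp add: apply_transfer_op[OF assms])

section \<open>Hilbert modules\<close>

lemma closed_submodule_limit: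
  assumes "closed_submodule act ip Z" "\<And>n :: nat. s n \<in> Z"
    and "(\<lambda>n. module_norm ip (s n - x)) \<longlonglongrightarrow> 0"
  shows "x \<in> Z"
proof -
  have "\<forall>s x. (\<forall>n::nat. s n \<in> Z) \<and> (\<lambda>n. module_norm ip (s n - x)) \<longlonglongrightarrow> 0 \<longrightarrow> x \<in> Z"
    using assms(1) unfolding closed_submodule_def by (elim conjE)
  then show ?thesis
    using assms(2,3) by (elim allE[of _ s] allE[of _ x] mp) simp
qed

context hilbert_module
begin

section \<open>Sesquilinearity, the Cauchy-Schwarz inequality and the module norm\<close>

lemma ip_add_left: "ip (x + y) z = ip x z + ip y z"
  unfolding ip_cnj[of "x + y" z] ip_cnj[of x z] ip_cnj[of y z] by (simp add: ip_add_right)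

lemma ip_act_left: "ip (act x a) y = cfun_cnj a * ip x y"
  unfolding ip_cnj[of "act x a" y] ip_cnj[of x y] by (simp add: ip_act_right mult.commute)

lemma ip_zero_right [simp]: "ip x 0 = 0"
  using ip_add_right[of x 0 0] by simp

lemma ip_zero_left [simp]: "ip 0 x = 0"
  using ip_add_left[of 0 0 x] by simp

lemma ip_minus_right: "ip x (- y) = - ip x y"
  using ip_add_right[of x y "- y"] by (simp add: eq_neg_iff_add_eq_0 add.commute)

lemma ip_minus_left: "ip (- x) y = - ip x y"
  using ip_add_left[of x "- x" y] by (simp add: eq_neg_iff_add_eq_0 add.commute)

lemma ip_diff_right: "ip x (y - z) = ip x y - ip x z"
  unfolding diff_conv_add_uminus ip_add_right ip_minus_right ..

lemma ip_diff_left: "ip (x - y) z = ip x z - ip y z"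
  unfolding diff_conv_add_uminus ip_add_left ip_minus_left ..

lemma ip_sum_right: "ip x (sum f A) = (\<Sum>i\<in>A. ip x (f i))"
  by (induction A rule: infinite_finite_induct) (simp_all add: ip_add_right)

lemma ip_sum_left: "ip (sum f A) x = (\<Sum>i\<in>A. ip (f i) x)"
  by (induction A rule: infinite_finite_induct) (simp_all add: ip_add_left)

lemmas ip_simps = ip_add_left ip_add_right ip_diff_left ip_diff_right ip_act_left ip_act_right

lemma nonneg_ip: "nonneg_cfun (ip x x)"
  by (simp add: nonneg_cfun_def ip_nonneg)

lemma nonneg_ip_mult: "nonneg_cfun (ip x y * ip y x)"
  unfolding ip_cnj[of x y] by (rule nonneg_cfun_cnj_mult)

lemma module_norm_nonneg: "0 \<le> module_norm ip x"
  by (simp add: module_norm_def)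

lemma module_norm_power2: "(module_norm ip x)\<^sup>2 = norm (ip x x)"
  by (simp add: module_norm_def)

lemma module_norm_minus_commute: "module_norm ip (x - y) = module_norm ip (y - x)"
proof -
  have "ip (x - y) (x - y) = ip (y - x) (y - x)"
    by (simp add: ip_simps)
  then show ?thesis
    by (simp add: module_norm_def)
qed

text \<open>The positivity of \<open>\<langle>w, w\<rangle>\<close> for \<open>w = y - x \<cdot> r\<langle>x, y\<rangle>\<close> with a suitable real \<open>r\<close>.\<close>

lemma ip_Cauchy_Schwarz: "(cmod (ip x y c))\<^sup>2 \<le> Re (ip x x c) * Re (ip y y c)"
proof -
  define n s v where "n = (cmod (ip x y c))\<^sup>2" and "s = Re (ip x x c)" and "v = Re (ip y y c)"
  have s: "0 \<le> s" "Im (ip x x c) = 0"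
    using nonneg_cfunD[OF nonneg_ip] by (auto simp: s_def)
  have quad: "0 \<le> v - 2 * r * n + r\<^sup>2 * n * s" for r
  proof -
    let ?w = "y - act x (r *\<^sub>R ip x y)"
    have "0 \<le> Re (ip ?w ?w c)"
      using nonneg_cfunD[OF nonneg_ip] by blast
    also have "ip ?w ?w c = ip y y c - ip y x c * (r *\<^sub>R ip x y c) - cnj (r *\<^sub>R ip x y c) * ip x y c
        + cnj (r *\<^sub>R ip x y c) * ip x x c * (r *\<^sub>R ip x y c)"
      by (simp add: ip_simps algebra_simps)
    also have "ip y x c = cnj (ip x y c)"
      by (subst ip_cnj) simp
    also have "Re (ip y y c - cnj (ip x y c) * (r *\<^sub>R ip x y c) - cnj (r *\<^sub>R ip x y c) * ip x y c
        + cnj (r *\<^sub>R ip x y c) * ip x x c * (r *\<^sub>R ip x y c)) = v - 2 * r * n + r\<^sup>2 * n * s"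
      using s(2) by (simp add: n_def s_def v_def cmod_power2) (simp add: power2_eq_square algebra_simps)
    finally show ?thesis .
  qed
  have "n \<le> s * v"
  proof (cases "s = 0")
    case True
    have "n = 0"
    proof (rule ccontr)
      assume "n \<noteq> 0"
      then show False
        \<comment> \<open>For this \<open>r\<close> and \<open>s = 0\<close> the quadratic equals
          -1.\<close>
        using quad[of "(v + 1) / (2 * n)"] True by simp
    qed
    then show ?thesis
      using True by simp
  next
    case False
    then show ?thesis
      \<comment> \<open>The quadratic is smallest at \<open>r = 1 / s\<close>, where it equals
        \<open>v - n / s\<close>.\<close>
      using s(1) quad[of "1 / s"] by (simp add: field_simps power2_eq_square)
  qed
  then show ?thesis
    by (simp add: n_def s_def v_def)
qed

lemma cmod_ip_le: "cmod (ip x y c) \<le> module_norm ip x * module_norm ip y"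
proof (rule power2_le_imp_le)
  have "Re (ip z z c) \<le> (module_norm ip z)\<^sup>2" for z
    unfolding module_norm_power2 by (meson complex_Re_le_cmod norm_bounded order_trans)
  then have "Re (ip x x c) * Re (ip y y c) \<le> (module_norm ip x)\<^sup>2 * (module_norm ip y)\<^sup>2"
    using nonneg_cfunD[OF nonneg_ip] by (intro mult_mono) auto
  then show "(cmod (ip x y c))\<^sup>2 \<le> (module_norm ip x * module_norm ip y)\<^sup>2"
    using ip_Cauchy_Schwarz[of x y c] by (simp add: power_mult_distrib)
qed (simp add: module_norm_nonneg)

lemma module_norm_triangle: "module_norm ip (x + y) \<le> module_norm ip x + module_norm ip y"
proof (rule power2_le_imp_le)
  show "(module_norm ip (x + y))\<^sup>2 \<le> (module_norm ip x + module_norm ip y)\<^sup>2"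
    unfolding module_norm_power2
  proof (rule norm_bound)
    fix c
    have "ip (x + y) (x + y) c = (ip x x c + ip x y c) + (ip y x c + ip y y c)"
      by (simp add: ip_simps)
    then have "norm (ip (x + y) (x + y) c) \<le>
        (cmod (ip x x c) + cmod (ip x y c)) + (cmod (ip y x c) + cmod (ip y y c))"
      by (simp only:) (intro norm_triangle_le add_mono norm_triangle_ineq)
    also have "\<dots> \<le> (module_norm ip x + module_norm ip y)\<^sup>2"
      using cmod_ip_le[of x x c] cmod_ip_le[of x y c] cmod_ip_le[of y x c] cmod_ip_le[of y y c]
      by (simp add: power2_eq_square algebra_simps)
    finally show "norm (ip (x + y) (x + y) c) \<le> (module_norm ip x + module_norm ip y)\<^sup>2" .
  qed
qed (simp add: module_norm_nonneg)

lemma module_norm_eq_0D: "module_norm ip x = 0 \<Longrightarrow> x = 0"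
  using ip_definite by (simp add: module_norm_def)

section \<open>Limits, Parseval identities and orthonormal bases\<close>

text \<open>Convergence at each point suffices, since positivity, which is to be carried to limits,
  is a pointwise condition.\<close>

lemma tendsto_ip_right:
  assumes "(\<lambda>n. module_norm ip (s n - x)) \<longlonglongrightarrow> 0"
  shows "(\<lambda>n. ip w (s n) c) \<longlonglongrightarrow> ip w x c"
proof -
  have "(\<lambda>n. ip w (s n) c - ip w x c) \<longlonglongrightarrow> 0"
  proof (rule Lim_null_comparison)
    show "\<forall>\<^sub>F n in sequentially.
        norm (ip w (s n) c - ip w x c) \<le> module_norm ip w * module_norm ip (s n - x)"
      using cmod_ip_le[of w "s _ - x" c] by (intro always_eventually allI) (simp add: ip_diff_right)
    show "(\<lambda>n. module_norm ip w * module_norm ip (s n - x)) \<longlonglongrightarrow> 0"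
      using tendsto_mult_right_zero[OF assms] by simp
  qed
  then show ?thesis
    using LIM_zero_iff by blast
qed

lemma tendsto_ip_left:
  assumes "(\<lambda>n. module_norm ip (s n - x)) \<longlonglongrightarrow> 0"
  shows "(\<lambda>n. ip (s n) w c) \<longlonglongrightarrow> ip x w c"
  using tendsto_cnj[OF tendsto_ip_right[OF assms, of w c]] ip_cnj[of _ w]
  by simp

lemma tendsto_ip_self:
  assumes "(\<lambda>n. module_norm ip (s n - x)) \<longlonglongrightarrow> 0"
  shows "(\<lambda>n. ip (s n) (s n) c) \<longlonglongrightarrow> ip x x c"
proof -
  have "(\<lambda>n. ip (s n - x) (s n - x) c) \<longlonglongrightarrow> 0"
  proof (rule Lim_null_comparison)
    show "\<forall>\<^sub>F n in sequentially.
        norm (ip (s n - x) (s n - x) c) \<le> module_norm ip (s n - x) * module_norm ip (s n - x)"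
      using cmod_ip_le by (simp add: always_eventually)
    show "(\<lambda>n. module_norm ip (s n - x) * module_norm ip (s n - x)) \<longlonglongrightarrow> 0"
      using tendsto_mult[OF assms assms] by simp
  qed
  then have "(\<lambda>n. ip (s n - x) (s n - x) c + ip (s n) x c + ip x (s n) c - ip x x c)
      \<longlonglongrightarrow> 0 + ip x x c + ip x x c - ip x x c"
    by (intro tendsto_intros tendsto_ip_left tendsto_ip_right assms)
  then show ?thesis
    by (simp add: ip_simps)
qed

text \<open>Bessel's inequality passes to limits pointwise. For the approximation at
  \<open>y\<close>, a finite set that serves a nearby \<open>z\<close> also serves \<open>y\<close>,
  up to twice the defects at \<open>z\<close> and at \<open>y - z\<close>.\<close>

lemma has_sum_ip_closure:
  assumes dense: "\<And>y e. e > 0 \<Longrightarrow> \<exists>z\<in>Z. module_norm ip (y - z) < e"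
    and sum: "\<And>z. z \<in> Z \<Longrightarrow> ((\<lambda>i. ip z (w i) * ip (w i) z) has_sum ip z z) I"
  shows "((\<lambda>i. ip y (w i) * ip (w i) y) has_sum ip y y) I"
proof -
  define B where "B F y = ip y y - (\<Sum>i\<in>F. ip y (w i) * ip (w i) y)" for F y
  have sum': "(\<forall>F. finite F \<and> F \<subseteq> I \<longrightarrow> nonneg_cfun (B F z)) \<and>
      (\<forall>e>0. \<exists>F. finite F \<and> F \<subseteq> I \<and> norm (B F z) \<le> e)" if "z \<in> Z" for z
    using iffD1[OF has_sum_nonneg_cfun_iff[OF nonneg_ip_mult] sum[OF that]] by (simp add: B_def)
  have bessel: "nonneg_cfun (B F y)" if F: "finite F" "F \<subseteq> I" for F y
  proof -
    have "\<exists>z. z \<in> Z \<and> module_norm ip (y - z) < inverse (real (Suc n))" for n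
      using dense[of "inverse (real (Suc n))" y] by auto
    then obtain s where s: "\<And>n. s n \<in> Z" "\<And>n. module_norm ip (y - s n) < inverse (real (Suc n))"
      by metis
    have lim: "(\<lambda>n. module_norm ip (s n - y)) \<longlonglongrightarrow> 0"
    proof (rule Lim_null_comparison[OF _ LIMSEQ_inverse_real_of_nat])
      show "\<forall>\<^sub>F n in sequentially. norm (module_norm ip (s n - y)) \<le> inverse (real (Suc n))"
        using s(2) by (intro always_eventually allI)
          (simp add: module_norm_nonneg module_norm_minus_commute[of _ y] less_imp_le)
    qed
    have "B F y c \<in> \<real>\<^sub>\<ge>\<^sub>0" for c
    proof (rule closed_sequentially[OF closed_nonneg_Reals_complex])
      show "B F (s n) c \<in> \<real>\<^sub>\<ge>\<^sub>0" for n
        using sum'[OF s(1)] F by (simp add: nonneg_cfun_def)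
      show "(\<lambda>n. B F (s n) c) \<longlonglongrightarrow> B F y c"
        unfolding B_def minus_bcontfun.rep_eq apply_bcontfun_sum apply_bcontfun_ring
        by (intro tendsto_intros tendsto_ip_self tendsto_ip_left tendsto_ip_right lim)
    qed
    then show ?thesis
      by (simp add: nonneg_cfun_def)
  qed
  have "\<exists>F. finite F \<and> F \<subseteq> I \<and> norm (B F y) \<le> e" if "e > 0" for e
  proof -
    \<comment> \<open>Both \<open>B F z\<close> and \<open>B F d\<close> will have norm at most
      \<open>e / 4\<close>, and each occurs twice in the final bound.\<close>
    obtain z where z: "z \<in> Z" "module_norm ip (y - z) < sqrt (e / 4)"
      using dense[of "sqrt (e / 4)"] \<open>e > 0\<close> by auto
    obtain F where F: "finite F" "F \<subseteq> I" "norm (B F z) \<le> e / 4"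
      using sum'[OF z(1)] \<open>e > 0\<close> by (meson zero_less_divide_iff zero_less_numeral)
    define d where "d = y - z"
    have "norm (ip d d) \<le> (sqrt (e / 4))\<^sup>2"
      using z(2) unfolding module_norm_power2[symmetric] d_def
      by (intro power_mono) (auto simp: module_norm_nonneg)
    moreover have "norm (B F d) \<le> norm (ip d d)"
      using bessel[OF F(1,2)] nonneg_ip_mult by (intro nonneg_cfun_norm_mono) (auto simp: B_def nonneg_cfun_sum)
    ultimately have d: "norm (B F d) \<le> e / 4"
      using \<open>e > 0\<close> by simp
    \<comment> \<open>The right side is positive by Bessel, so \<open>B F (z + d)\<close>, which is
      \<open>B F y\<close>, is dominated by the other terms.\<close>
    have parallelogram: "(B F z + B F z + (B F d + B F d)) - B F (z + d) = B F (z - d)"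
      unfolding B_def by (simp add: ip_simps algebra_simps sum.distrib sum_subtractf)
    have "norm (B F (z + d)) \<le> norm (B F z + B F z + (B F d + B F d))"
      using bessel[OF F(1,2)] by (intro nonneg_cfun_norm_mono) (simp_all only: parallelogram)
    also have "\<dots> \<le> (norm (B F z) + norm (B F z)) + (norm (B F d) + norm (B F d))"
      by (intro norm_triangle_le add_mono norm_triangle_ineq)
    also have "\<dots> \<le> e"
      using d F(3) by simp
    finally show ?thesis
      using F by (auto simp: d_def)
  qed
  then show ?thesis
    using bessel by (intro iffD2[OF has_sum_nonneg_cfun_iff[OF nonneg_ip_mult]]) (simp add: B_def)
qed

text \<open>What remains is generation: the partial Fourier sums of \<open>z\<close> lie in every
  closed submodule containing the family, and they converge to \<open>z\<close> because their
  squared distance from it is the Parseval defect.\<close>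

lemma orthonormal_basis_of_parseval_frame:
  assumes frame: "parseval_frame act ip Z x J"
    and on: "\<And>j k. j \<in> J \<Longrightarrow> k \<in> J \<Longrightarrow> ip (x j) (x k) = (if j = k then 1 else 0)"
  shows "orthonormal_basis act ip Z x J"
proof -
  have "z \<in> W" if z: "z \<in> Z" and W: "closed_submodule act ip W" "x ` J \<subseteq> W" for z W
  proof -
    define p where "p F = (\<Sum>i\<in>F. act (x i) (ip (x i) z))" for F
    have mem: "p F \<in> W" if "finite F" "F \<subseteq> J" for F
      using that
    proof (induction F rule: finite_induct)
      case (insert i F)
      then show ?case
        using W unfolding closed_submodule_def p_def by auto
    qed (use W in \<open>simp add: closed_submodule_def p_def\<close>)
    have dist: "ip (p F - z) (p F - z) = ip z z - (\<Sum>i\<in>F. ip z (x i) * ip (x i) z)"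
      if "finite F" "F \<subseteq> J" for F
    proof -
      have left: "ip (p F) y = (\<Sum>i\<in>F. ip z (x i) * ip (x i) y)" for y
        using ip_cnj[of z] by (simp add: p_def ip_sum_left ip_act_left)
      have "ip (x i) (p F) = ip (x i) z" if "i \<in> F" for i
      proof -
        have "ip (x i) (p F) = (\<Sum>j\<in>F. (if i = j then 1 else 0) * ip (x j) z)"
          unfolding p_def ip_sum_right ip_act_right
          using that \<open>F \<subseteq> J\<close> by (intro sum.cong refl arg_cong2[where f = "(*)"] on) auto
        also have "\<dots> = (\<Sum>j\<in>F. if i = j then ip (x j) z else 0)"
          by (intro sum.cong) auto
        also have "\<dots> = ip (x i) z"
          using that \<open>finite F\<close> by simp
        finally show ?thesis .
      qed
      then have "ip (p F) (p F) = ip (p F) z"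
        unfolding left by simp
      moreover have "ip z (p F) = (\<Sum>i\<in>F. ip z (x i) * ip (x i) z)"
        by (simp add: p_def ip_sum_right ip_act_right)
      ultimately show ?thesis
        by (simp add: ip_diff_left ip_diff_right left)
    qed
    have "((\<lambda>j. ip z (x j) * ip (x j) z) has_sum ip z z) J"
      using frame z by (simp add: parseval_frame_def)
    note approx = iffD1[OF has_sum_nonneg_cfun_iff[OF nonneg_ip_mult] this, THEN conjunct2]
    have "\<exists>F. finite F \<and> F \<subseteq> J \<and> norm (ip (p F - z) (p F - z)) \<le> inverse (real (Suc n))" for n
      using approx[rule_format, of "inverse (real (Suc n))"] dist by auto
    then obtain F where F: "\<And>n. finite (F n)" "\<And>n. F n \<subseteq> J"
      "\<And>n. norm (ip (p (F n) - z) (p (F n) - z)) \<le> inverse (real (Suc n))"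
      by metis
    have "(\<lambda>n. norm (ip (p (F n) - z) (p (F n) - z))) \<longlonglongrightarrow> 0"
      by (rule Lim_null_comparison[OF _ LIMSEQ_inverse_real_of_nat])
        (use F(3) in \<open>simp add: always_eventually\<close>)
    then have "(\<lambda>n. module_norm ip (p (F n) - z)) \<longlonglongrightarrow> 0"
      unfolding module_norm_def using tendsto_real_sqrt by fastforce
    then show "z \<in> W"
      by (rule closed_submodule_limit[OF W(1), rotated]) (rule mem[OF F(1,2)])
  qed
  \<comment> \<open>The other inclusion holds because \<open>Z\<close> is itself a closed submodule
    containing the family.\<close>
  then have "generated_submodule act ip (x ` J) = Z"
    using frame unfolding generated_submodule_def parseval_frame_def by blast
  then show ?thesis
    using frame on by (simp add: orthonormal_basis_def parseval_frame_def)
qed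

end

section \<open>Inner-product preserving maps\<close>

text \<open>The inner square of \<open>T (x + y) - (T x + T y)\<close> expands into inner products
  that cancel as they do in the source, and definiteness applies; likewise for the action. This
  yields the linearity of \<open>Q\<close>.\<close>

lemma ip_preserving_imp_module_map:
  assumes "hilbert_module act ip" "hilbert_module act' ip'" "ip_preserving ip ip' T"
  shows "module_map act act' T"
proof -
  interpret X: hilbert_module act ip by fact
  interpret Y: hilbert_module act' ip' by fact
  have T: "ip' (T x) (T y) = ip x y" for x y
    using assms(3) by (simp add: ip_preserving_def)
  have "T (x + y) - (T x + T y) = 0" for x y
    by (rule Y.ip_definite) (simp add: Y.ip_simps X.ip_simps T)
  moreover have "T (act x a) - act' (T x) a = 0" for x a
    by (rule Y.ip_definite) (simp add: Y.ip_simps X.ip_simps T)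
  ultimately show ?thesis
    by (simp add: module_map_def)
qed

text \<open>Since \<open>T\<close> is isometric, a convergent sequence in its range comes from a
  Cauchy sequence; the image of the limit of the latter is the required limit.\<close>

lemma closed_submodule_range_ip_preserving:
  assumes "hilbert_module act ip" "hilbert_module act' ip'" "ip_preserving ip ip' T"
  shows "closed_submodule act' ip' (range T)"
proof -
  interpret X: hilbert_module act ip by fact
  interpret Y: hilbert_module act' ip' by fact
  have T: "T (x + y) = T x + T y" "T (act x a) = act' (T x) a" for x y a
    using ip_preserving_imp_module_map[OF assms] by (auto simp: module_map_def)
  have T0: "T 0 = 0"
    using T(1)[of 0 0] by simp
  have T_diff: "T (x - y) = T x - T y" for x y
    using T(1)[of "x - y" y] by (simp add: algebra_simps)
  have norm_T: "module_norm ip' (T x) = module_norm ip x" for x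
    using assms(3) by (simp add: module_norm_def ip_preserving_def)
  have "x \<in> range T"
    if s: "\<forall>n::nat. s n \<in> range T" and lim: "(\<lambda>n. module_norm ip' (s n - x)) \<longlonglongrightarrow> 0" for s x
  proof -
    obtain t where t: "\<And>n. s n = T (t n)"
      using s unfolding image_iff by metis
    have "\<exists>N. \<forall>m\<ge>N. \<forall>n\<ge>N. module_norm ip (t m - t n) < e" if "e > 0" for e
    proof -
      obtain N where N: "\<And>n. n \<ge> N \<Longrightarrow> module_norm ip' (s n - x) < e / 2"
        using lim \<open>e > 0\<close> Y.module_norm_nonneg unfolding LIMSEQ_def
        by (metis abs_of_nonneg diff_zero dist_real_def half_gt_zero)
      have "module_norm ip (t m - t n) < e" if "m \<ge> N" "n \<ge> N" for m n
      proof -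
        have "module_norm ip (t m - t n) = module_norm ip' ((s m - x) + (x - s n))"
          by (simp add: t T_diff flip: norm_T)
        also have "\<dots> \<le> module_norm ip' (s m - x) + module_norm ip' (x - s n)"
          by (rule Y.module_norm_triangle)
        also have "\<dots> < e"
          using N[OF that(1)] N[OF that(2)] Y.module_norm_minus_commute[of x] by simp
        finally show ?thesis .
      qed
      then show ?thesis
        by blast
    qed
    then obtain y where y: "(\<lambda>n. module_norm ip (t n - y)) \<longlonglongrightarrow> 0"
      using X.complete by blast
    have "module_norm ip' (T y - x) \<le> module_norm ip (t n - y) + module_norm ip' (s n - x)" for n
    proof -
      have "module_norm ip' (T y - x) = module_norm ip' ((T y - T (t n)) + (s n - x))"
        by (simp add: t)
      also have "\<dots> \<le> module_norm ip' (T y - T (t n)) + module_norm ip' (s n - x)"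
        by (rule Y.module_norm_triangle)
      also have "module_norm ip' (T y - T (t n)) = module_norm ip (t n - y)"
        unfolding T_diff[symmetric] norm_T by (rule X.module_norm_minus_commute)
      finally show ?thesis .
    qed
    moreover have "(\<lambda>n. module_norm ip (t n - y) + module_norm ip' (s n - x)) \<longlonglongrightarrow> 0"
      using tendsto_add[OF y lim] by simp
    ultimately have "module_norm ip' (T y - x) \<le> 0"
      by (intro LIMSEQ_le_const) auto
    then have "T y - x = 0"
      using Y.module_norm_nonneg by (intro Y.module_norm_eq_0D order_antisym)
    then show "x \<in> range T"
      by (metis eq_iff_diff_eq_0 rangeI)
  qed
  then show ?thesis
    unfolding closed_submodule_def using T T0 by (auto simp: image_iff) metis+
qed

section \<open>The direct limit\<close>

text \<open>Besides the frame and the limit, the argument uses only algebraic properties of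
  \<open>\<alpha>\<close> and \<open>L\<close> and the boundedness of \<open>L\<close>; the local
  homeomorphism enters when these are verified.\<close>

locale correspondence_limit = hilbert_module act ip
  for act :: "'y::ab_group_add \<Rightarrow> ('c::topological_space \<Rightarrow>\<^sub>C complex) \<Rightarrow> 'y" and ip +
  fixes \<alpha> L :: "('c \<Rightarrow>\<^sub>C complex) \<Rightarrow> ('c \<Rightarrow>\<^sub>C complex)"
    and m :: "nat \<Rightarrow> ('c \<Rightarrow>\<^sub>C complex)" and J :: "nat set"
    and \<iota> :: "nat \<Rightarrow> ('c \<Rightarrow>\<^sub>C complex) \<Rightarrow> 'y"
  assumes endo_one: "\<alpha> 1 = 1"
    and endo_mult: "\<alpha> (f * g) = \<alpha> f * \<alpha> g"
    and endo_cnj: "\<alpha> (cfun_cnj f) = cfun_cnj (\<alpha> f)"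
    and transfer_linear: "bounded_linear L"
    and transfer_mult_endo: "L (f * \<alpha> g) = L f * g"
    and transfer_cnj: "L (cfun_cnj f) = cfun_cnj (L f)"
    and zero_mem: "0 \<in> J"
    and frame: "parseval_frame (corr_act \<alpha>) (corr_ip L) UNIV m J"
    and limit: "hilbert_direct_limit (\<lambda>k. corr_act (\<alpha> ^^ k)) (\<lambda>k. corr_ip (L ^^ k))
      (\<lambda>k n. m 0 * \<alpha> n) act ip \<iota>"
begin

text \<open>The image of \<open>m\<^bsub>j1\<^esub> \<otimes> \<dots> \<otimes> m\<^bsub>jk\<^esub>\<close> under the identification of the tensor power with a
  twisted copy of \<open>C(C)\<close>.\<close>

primrec word :: "nat list \<Rightarrow> ('c \<Rightarrow>\<^sub>C complex)" where
  "word [] = 1"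
| "word (j # js) = m j * \<alpha> (word js)"

text \<open>The recursion serves the inductions, while the product occurs in \<open>wavelet\<close>.
  With indices shifted to start at 0, multiplicativity of \<open>\<alpha>\<close> gives the
  step.\<close>

lemma word_eq_prod:
  "word js = (\<Prod>l = 1..length js. (\<alpha> ^^ (l - 1)) (m (js ! (l - 1))))"
proof (induction js)
  case (Cons j js)
  have endo_prod: "\<alpha> (\<Prod>i\<in>A. f i) = (\<Prod>i\<in>A. \<alpha> (f i))" for f and A :: "nat set"
    by (induction A rule: infinite_finite_induct) (simp_all add: endo_one endo_mult)
  have "(\<Prod>l = 1..length (j # js). (\<alpha> ^^ (l - 1)) (m ((j # js) ! (l - 1)))) =
      (\<Prod>l<Suc (length js). (\<alpha> ^^ l) (m ((j # js) ! l)))"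
    by (simp only: prod.atLeast1_atMost_eq One_nat_def list.size(4) add_0_right add_Suc_right diff_Suc_Suc minus_nat.diff_0)
  also have "\<dots> = m j * (\<Prod>l<length js. \<alpha> ((\<alpha> ^^ l) (m (js ! l))))"
    unfolding prod.lessThan_Suc_shift by simp
  finally show ?case
    by (simp add: Cons.IH prod.atLeast1_atMost_eq endo_prod)
qed simp

section \<open>Tensor powers inside the limit\<close>

lemma ip_embed: "ip (\<iota> k x) (\<iota> k y) = (L ^^ k) (cfun_cnj x * y)"
  using limit by (simp add: hilbert_direct_limit_def ip_preserving_def corr_ip_def)

lemma embed_link: "\<iota> (Suc k) (m 0 * \<alpha> n) = \<iota> k n"
  using limit by (simp add: hilbert_direct_limit_def)

lemma embed_act: "\<iota> k (n * (\<alpha> ^^ k) f) = act (\<iota> k n) f"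
  using limit by (simp add: hilbert_direct_limit_def module_map_def corr_act_def)

lemma bounded_linear_transfer_power: "bounded_linear (L ^^ k)"
  by (induction k) (simp_all add: id_def bounded_linear_ident comp_def
      bounded_linear_compose[OF transfer_linear])

text \<open>The adjoint of tensoring with \<open>m j\<close> on the left: the innermost
  \<open>L\<close> is split off the iterate, and \<open>transfer_mult_endo\<close> pulls the
  conjugate of \<open>n\<close> out of it.\<close>

lemma ip_embed_Suc:
  "ip (\<iota> (Suc k) (m j * \<alpha> n)) (\<iota> (Suc k) x) = ip (\<iota> k n) (\<iota> k (L (cfun_cnj (m j) * x)))"
proof -
  have "L (cfun_cnj (m j * \<alpha> n) * x) = L (cfun_cnj (m j) * x * \<alpha> (cfun_cnj n))"
    by (simp add: endo_cnj mult_ac)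
  also have "\<dots> = cfun_cnj n * L (cfun_cnj (m j) * x)"
    unfolding transfer_mult_endo by (rule mult.commute)
  finally show ?thesis
    by (simp add: ip_embed funpow_Suc_right del: funpow.simps)
qed

text \<open>Splitting off the first letter gives a double sum. Its inner sums are the claim for
  \<open>k\<close> at \<open>y j\<close>; its outer sum is the frame identity of \<open>m\<close>
  under the bounded map \<open>L ^^ k\<close>.\<close>

lemma has_sum_words:
  "((\<lambda>js. ip (\<iota> k x) (\<iota> k (word js)) * ip (\<iota> k (word js)) (\<iota> k x)) has_sum ip (\<iota> k x) (\<iota> k x))
     {js. length js = k \<and> set js \<subseteq> J}"
proof (induction k arbitrary: x)
  case 0
  have "{js. length js = 0 \<and> set js \<subseteq> J} = {[]}"
    by auto
  then show ?case
    by (simp add: ip_embed has_sum_finite_iff)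
next
  case (Suc k)
  define y where "y j = L (cfun_cnj (m j) * x)" for j
  let ?W = "{js. length js = k \<and> set js \<subseteq> J}"
  let ?t = "\<lambda>js. ip (\<iota> (Suc k) x) (\<iota> (Suc k) (word js)) * ip (\<iota> (Suc k) (word js)) (\<iota> (Suc k) x)"
  have step: "ip (\<iota> (Suc k) (word (j # js))) (\<iota> (Suc k) x) = ip (\<iota> k (word js)) (\<iota> k (y j))"
    "ip (\<iota> (Suc k) x) (\<iota> (Suc k) (word (j # js))) = ip (\<iota> k (y j)) (\<iota> k (word js))" for j js
    by (simp_all add: ip_embed_Suc y_def) (metis ip_embed_Suc ip_cnj)
  have "((\<lambda>j. corr_ip L x (m j) * corr_ip L (m j) x) has_sum corr_ip L x x) J"
    using frame by (simp add: parseval_frame_def)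
  then have "((\<lambda>j. (L ^^ k) (corr_ip L x (m j) * corr_ip L (m j) x)) has_sum (L ^^ k) (corr_ip L x x)) J"
    by (rule has_sum_bounded_linear[OF bounded_linear_transfer_power])
  \<comment> \<open>Under \<open>L ^^ k\<close> this becomes the inner square of
    \<open>\<iota> k (y j)\<close>, the value of the inner sum.\<close>
  moreover have "corr_ip L x (m j) * corr_ip L (m j) x = cfun_cnj (y j) * y j" for j
    by (simp add: corr_ip_def y_def mult.commute flip: transfer_cnj)
  ultimately have outer: "((\<lambda>j. ip (\<iota> k (y j)) (\<iota> k (y j))) has_sum ip (\<iota> (Suc k) x) (\<iota> (Suc k) x)) J"
    by (simp add: ip_embed corr_ip_def funpow_Suc_right del: funpow.simps)
  have "((\<lambda>(j, js). ?t (j # js)) has_sum ip (\<iota> (Suc k) x) (\<iota> (Suc k) x)) (J \<times> ?W)"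
    by (rule has_sum_Sigma_nonneg_cfun[OF _ _ outer])
      (simp_all only: prod.case step nonneg_ip_mult Suc.IH)
  moreover have "bij_betw (\<lambda>(j, js). j # js) (J \<times> ?W) {js. length js = Suc k \<and> set js \<subseteq> J}"
    by (rule bij_betw_byWitness[where f' = "\<lambda>js. (hd js, tl js)"]) (auto simp: length_Suc_conv)
  ultimately show ?case
    using has_sum_reindex_bij_betw[of "\<lambda>(j, js). j # js" "J \<times> ?W" _ ?t]
    by (simp add: case_prod_unfold)
qed

text \<open>Moving the first letter across leaves the shorter word or 0, by orthonormality of
  \<open>m\<close>.\<close>

lemma ip_words:
  assumes "\<And>i j. i \<in> J \<Longrightarrow> j \<in> J \<Longrightarrow> corr_ip L (m i) (m j) = (if i = j then 1 else 0)"
  shows "length js = k \<Longrightarrow> length js' = k \<Longrightarrow> set js \<subseteq> J \<Longrightarrow> set js' \<subseteq> J \<Longrightarrow>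
    ip (\<iota> k (word js)) (\<iota> k (word js')) = (if js = js' then 1 else 0)"
proof (induction k arbitrary: js js')
  case 0
  then show ?case
    by (simp add: ip_embed)
next
  case (Suc k)
  obtain i is0 j js0 where eq: "js = i # is0" "js' = j # js0"
    using Suc.prems(1,2) by (metis length_Suc_conv)
  have "L (cfun_cnj (m i) * word js') = L (cfun_cnj (m i) * m j) * word js0"
    by (simp add: eq transfer_mult_endo flip: mult.assoc)
  also have "\<dots> = (if i = j then word js0 else 0)"
    using assms[of i j] Suc.prems by (auto simp: eq corr_ip_def)
  finally have "ip (\<iota> (Suc k) (word js)) (\<iota> (Suc k) (word js')) =
      ip (\<iota> k (word is0)) (\<iota> k (if i = j then word js0 else 0))"
    by (simp add: eq(1) ip_embed_Suc)
  moreover have "ip (\<iota> k x) (\<iota> k 0) = 0" for x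
    using bounded_linear.linear[OF bounded_linear_transfer_power]
    by (simp add: ip_embed linear_0)
  ultimately show ?case
    using Suc.IH[of is0 js0] Suc.prems by (auto simp: eq)
qed

section \<open>Wavelet indices as words without leading zeros\<close>

text \<open>These vectors of the limit are the ones that \<open>Q\<close> will carry to the family
  \<open>wavelet\<close>.\<close>

definition wavelet_vec :: "nat list option \<Rightarrow> 'y" where
  "wavelet_vec i = (case i of None \<Rightarrow> \<iota> 0 1 | Some js \<Rightarrow> \<iota> (length js) (word js))"

definition wavelet_level :: "nat list option \<Rightarrow> nat" where
  "wavelet_level i = (case i of None \<Rightarrow> 0 | Some js \<Rightarrow> length js)"

text \<open>Tensoring with \<open>m\<^sub>0\<close> on the left is the linking map of the direct system, so an index of level at
  most \<open>k\<close> may be padded with leading zeros to length \<open>k\<close>.\<close>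

definition pad :: "nat \<Rightarrow> nat list option \<Rightarrow> nat list" where
  "pad k i = (case i of None \<Rightarrow> replicate k 0 | Some js \<Rightarrow> replicate (k - length js) 0 @ js)"

text \<open>Words of zeros only, the empty one included, represent \<open>\<iota> 0 1\<close> in the
  limit, hence \<open>None\<close>.\<close>

definition unpad :: "nat list \<Rightarrow> nat list option" where
  "unpad js = (let ds = dropWhile (\<lambda>j. j = 0) js in if ds = [] then None else Some ds)"

text \<open>A tuple in the index set starts with a positive entry, so \<open>dropWhile\<close>
  removes the padding and nothing more.\<close>

lemma unpad_pad:
  assumes "i \<in> wavelet_index J"
  shows "unpad (pad k i) = i"
proof (cases i)
  case None
  then show ?thesis
    by (simp add: pad_def unpad_def Let_def)
next
  case (Some js)
  then have "js \<noteq> []" "hd js > 0"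
    using assms by (auto simp: wavelet_index_def)
  then have "dropWhile (\<lambda>j. j = 0) js = js"
    by (cases js) auto
  then have "dropWhile (\<lambda>j. j = 0) (replicate n 0 @ js) = js" for n
    by (induction n) simp_all
  then show ?thesis
    using \<open>js \<noteq> []\<close> by (simp add: Some pad_def unpad_def Let_def)
qed

lemma set_pad:
  assumes "i \<in> wavelet_index J"
  shows "set (pad k i) \<subseteq> J"
  using assms zero_mem by (auto simp: wavelet_index_def pad_def)

lemma length_pad: "wavelet_level i \<le> k \<Longrightarrow> length (pad k i) = k"
  by (auto simp: wavelet_level_def pad_def split: option.splits)

lemma pad_unpad: "pad (length js) (unpad js) = js"
proof -
  define ts ds where "ts = takeWhile (\<lambda>j. j = 0) js" and "ds = dropWhile (\<lambda>j. j = 0) js"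
  have js: "js = ts @ ds"
    by (simp add: ts_def ds_def)
  have ts: "replicate (length ts) 0 = ts"
    by (rule replicate_length_same) (auto simp: ts_def dest: set_takeWhileD)
  show ?thesis
    unfolding pad_def unpad_def ds_def[symmetric] by (auto simp: js ts)
qed

lemma unpad_mem:
  assumes "set js \<subseteq> J"
  shows "unpad js \<in> wavelet_index J \<and> wavelet_level (unpad js) \<le> length js"
proof -
  define ds where "ds = dropWhile (\<lambda>j. j = 0) js"
  have "set ds \<subseteq> J"
    using assms set_dropWhileD unfolding ds_def by fast
  moreover have "hd ds \<noteq> 0" if "ds \<noteq> []"
    using hd_dropWhile that unfolding ds_def by fast
  moreover have "length ds \<le> length js"
    unfolding ds_def by (rule length_dropWhile_le)
  ultimately show ?thesis
    unfolding unpad_def ds_def[symmetric] by (auto simp: wavelet_index_def wavelet_level_def)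
qed

lemma embed_word_replicate: "\<iota> (n + length js) (word (replicate n 0 @ js)) = \<iota> (length js) (word js)"
  by (induction n) (simp_all add: embed_link)

lemma embed_pad:
  assumes "wavelet_level i \<le> k"
  shows "\<iota> k (word (pad k i)) = wavelet_vec i"
proof (cases i)
  case None
  then show ?thesis
    using embed_word_replicate[of k "[]"] by (simp add: pad_def wavelet_vec_def)
next
  case (Some js)
  then show ?thesis
    using assms embed_word_replicate[of "k - length js" js]
    by (simp add: pad_def wavelet_vec_def wavelet_level_def)
qed

text \<open>\<open>pad k\<close> is a bijection onto the words of length \<open>k\<close> that
  preserves the represented vector, so \<open>has_sum_words\<close> is reindexed along it.\<close>

lemma has_sum_wavelet_level:
  "((\<lambda>i. ip (\<iota> k x) (wavelet_vec i) * ip (wavelet_vec i) (\<iota> k x)) has_sum ip (\<iota> k x) (\<iota> k x))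
     {i \<in> wavelet_index J. wavelet_level i \<le> k}"
proof -
  have "bij_betw (pad k) {i \<in> wavelet_index J. wavelet_level i \<le> k} {js. length js = k \<and> set js \<subseteq> J}"
    by (rule bij_betw_byWitness[where f' = unpad])
      (use unpad_pad subsetD[OF set_pad] length_pad pad_unpad unpad_mem in auto)
  then have "((\<lambda>i. ip (\<iota> k x) (\<iota> k (word (pad k i))) * ip (\<iota> k (word (pad k i))) (\<iota> k x))
      has_sum ip (\<iota> k x) (\<iota> k x)) {i \<in> wavelet_index J. wavelet_level i \<le> k}"
    using has_sum_words has_sum_reindex_bij_betw[of "pad k" _ _
        "\<lambda>js. ip (\<iota> k x) (\<iota> k (word js)) * ip (\<iota> k (word js)) (\<iota> k x)"] by blast
  then show ?thesis
    by (rule has_sum_cong[THEN iffD1, rotated]) (simp add: embed_pad)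
qed

lemma range_embed_mono:
  assumes "k \<le> l"
  shows "range (\<iota> k) \<subseteq> range (\<iota> l)"
  using assms
proof (induction rule: dec_induct)
  case (step l)
  have "range (\<iota> l) \<subseteq> range (\<iota> (Suc l))"
    using embed_link by (metis image_subsetI rangeI)
  with step show ?case
    by blast
qed simp

text \<open>An element of level \<open>k\<close> belongs to all later levels too. A level covering a
  given finite set yields Bessel, level \<open>k\<close> itself yields the approximation, and
  density does the rest.\<close>

lemma has_sum_wavelet_vec:
  "((\<lambda>i. ip y (wavelet_vec i) * ip (wavelet_vec i) y) has_sum ip y y) (wavelet_index J)"
proof (rule has_sum_ip_closure)
  show "\<exists>z\<in>\<Union>k. range (\<iota> k). module_norm ip (y - z) < e" if "e > 0" for y e
    using limit that unfolding hilbert_direct_limit_def by blast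
next
  fix z assume "z \<in> (\<Union>k. range (\<iota> k))"
  then obtain k where k: "z \<in> range (\<iota> k)"
    by blast
  let ?t = "\<lambda>i. ip z (wavelet_vec i) * ip (wavelet_vec i) z"
  let ?G = "\<lambda>l. {i \<in> wavelet_index J. wavelet_level i \<le> l}"
  have level: "(?t has_sum ip z z) (?G l)" if l: "l \<ge> k" for l
  proof -
    obtain x where "z = \<iota> l x"
      using k range_embed_mono[OF l] by blast
    then show ?thesis
      using has_sum_wavelet_level[of l x] by simp
  qed
  note level' = iffD1[OF has_sum_nonneg_cfun_iff[OF nonneg_ip_mult] level]
  show "(?t has_sum ip z z) (wavelet_index J)"
  proof (rule iffD2[OF has_sum_nonneg_cfun_iff[OF nonneg_ip_mult]]; (intro conjI allI impI)?)
    fix F assume F: "finite F \<and> F \<subseteq> wavelet_index J"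
    \<comment> \<open>For empty \<open>F\<close> the value of \<open>Max\<close> is unspecified; the
      outer \<open>max\<close> keeps the level at least \<open>k\<close>.\<close>
    have "\<forall>i\<in>F. wavelet_level i \<le> max k (Max (wavelet_level ` F))"
      using F by (auto simp: le_max_iff_disj)
    then have "F \<subseteq> ?G (max k (Max (wavelet_level ` F)))"
      using F by blast
    then show "nonneg_cfun (ip z z - sum ?t F)"
      using level'[of "max k (Max (wavelet_level ` F))"] F by simp
  next
    fix e :: real assume "e > 0"
    then obtain F where "finite F" "F \<subseteq> ?G k" "norm (ip z z - sum ?t F) \<le> e"
      using level'[of k] by blast
    then show "\<exists>F. finite F \<and> F \<subseteq> wavelet_index J \<and> norm (ip z z - sum ?t F) \<le> e"
      by blast
  qed
qed

text \<open>Padded to a common level, both vectors become words of equal length, and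
  \<open>unpad\<close> shows that distinct indices give distinct words.\<close>

lemma ip_wavelet_vec:
  assumes "\<And>i j. i \<in> J \<Longrightarrow> j \<in> J \<Longrightarrow> corr_ip L (m i) (m j) = (if i = j then 1 else 0)"
    and "i \<in> wavelet_index J" "j \<in> wavelet_index J"
  shows "ip (wavelet_vec i) (wavelet_vec j) = (if i = j then 1 else 0)"
proof -
  define k where "k = max (wavelet_level i) (wavelet_level j)"
  have "ip (\<iota> k (word (pad k i))) (\<iota> k (word (pad k j))) = (if pad k i = pad k j then 1 else 0)"
    using assms set_pad by (intro ip_words) (simp_all add: k_def length_pad)
  moreover have "pad k i = pad k j \<longleftrightarrow> i = j"
    using assms unpad_pad by metis
  ultimately show ?thesis
    by (simp add: embed_pad k_def)
qed

end

section \<open>Transport from the limit to \<open>X\<close> along \<open>Q\<close>\<close>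

theorem corollary4p7:
  fixes \<sigma> :: "'c::t2_space \<Rightarrow> 'c"
    and m :: "nat \<Rightarrow> ('c \<Rightarrow>\<^sub>C complex)" and J :: "nat set"
    and actX :: "'x::ab_group_add \<Rightarrow> ('c \<Rightarrow>\<^sub>C complex) \<Rightarrow> 'x"
    and ipX :: "'x \<Rightarrow> 'x \<Rightarrow> ('c \<Rightarrow>\<^sub>C complex)"
    and \<phi> :: 'x and D :: "'x \<Rightarrow> 'x"
    and actY :: "'y::ab_group_add \<Rightarrow> ('c \<Rightarrow>\<^sub>C complex) \<Rightarrow> 'y"
    and ipY :: "'y \<Rightarrow> 'y \<Rightarrow> ('c \<Rightarrow>\<^sub>C complex)"
    and \<iota> :: "nat \<Rightarrow> ('c \<Rightarrow>\<^sub>C complex) \<Rightarrow> 'y"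
    and R :: "'y \<Rightarrow> 'y" and Q :: "'y \<Rightarrow> 'x"
  defines "\<alpha> \<equiv> endo \<sigma>" and "L \<equiv> transfer_op \<sigma>"
  assumes "compact (UNIV :: 'c set)"
    and "surj \<sigma>" and "local_homeomorphism \<sigma>"
    and "J = UNIV \<or> (\<exists>N. J = {..N})"
    and "parseval_frame (corr_act \<alpha>) (corr_ip L) UNIV m J"
    and "corr_ip L (m 0) (m 0) = 1"
    and "hilbert_module actX ipX"
    and "ipX \<phi> \<phi> = 1"
    and "hilbert_module_iso actX ipX (twist_act \<alpha> actX) (twist_ip L ipX) D"
    and "D \<phi> = actX \<phi> (m 0)"
    and "hilbert_direct_limit (\<lambda>k. corr_act (\<alpha> ^^ k)) (\<lambda>k. corr_ip (L ^^ k))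
           (\<lambda>k n. m 0 * \<alpha> n) actY ipY \<iota>"
    and "hilbert_module_iso actY ipY (twist_act \<alpha> actY) (twist_ip L ipY) R"
    and "\<And>k n. R (\<iota> (Suc k) n) = \<iota> k n"
    and "ip_preserving ipY ipX Q"
    and "Q (\<iota> 0 1) = \<phi>"
    and "D \<circ> Q = Q \<circ> R"
  shows "parseval_frame actX ipX (range Q) (wavelet \<alpha> actX D \<phi> m) (wavelet_index J) \<and>
    (orthonormal_basis (corr_act \<alpha>) (corr_ip L) UNIV m J \<longrightarrow>
       orthonormal_basis actX ipX (range Q) (wavelet \<alpha> actX D \<phi> m) (wavelet_index J))"
proof -
  note comp = \<open>compact UNIV\<close> and loc = \<open>local_homeomorphism \<sigma>\<close>
  note top = comp loc \<open>surj \<sigma>\<close>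
  have Y: "hilbert_module actY ipY"
    using \<open>hilbert_direct_limit _ _ _ actY ipY \<iota>\<close> by (simp add: hilbert_direct_limit_def)
  interpret X: hilbert_module actX ipX by fact
  interpret Y: hilbert_module actY ipY by fact
  interpret Y: correspondence_limit actY ipY \<alpha> L m J \<iota>
  proof (rule correspondence_limit.intro[OF Y correspondence_limit_axioms.intro])
    show "\<alpha> 1 = 1"
      unfolding \<alpha>_def by (rule bcontfun_eqI) (simp add: apply_endo[OF comp loc])
    show "\<alpha> (f * g) = \<alpha> f * \<alpha> g" for f g
      unfolding \<alpha>_def by (rule bcontfun_eqI) (simp add: apply_endo[OF comp loc])
    show "\<alpha> (cfun_cnj f) = cfun_cnj (\<alpha> f)" for f
      unfolding \<alpha>_def by (rule bcontfun_eqI) (simp add: apply_endo[OF comp loc])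
    show "bounded_linear L"
      unfolding L_def by (rule bounded_linear_transfer_op[OF top])
    show "L (f * \<alpha> g) = L f * g" for f g
      unfolding L_def \<alpha>_def by (rule transfer_op_mult_endo[OF top])
    show "L (cfun_cnj f) = cfun_cnj (L f)" for f
      unfolding L_def by (rule transfer_op_cnj[OF top])
    show "0 \<in> J"
      using \<open>J = UNIV \<or> (\<exists>N. J = {..N})\<close> by auto
  qed fact+
  have ip_Q: "ipX (Q x) (Q y) = ipY x y" for x y
    using \<open>ip_preserving ipY ipX Q\<close> by (simp add: ip_preserving_def)
  have act_Q: "Q (actY x a) = actX (Q x) a" for x a
    using ip_preserving_imp_module_map[OF Y X.hilbert_module_axioms \<open>ip_preserving ipY ipX Q\<close>]
    by (simp add: module_map_def)
  have "bij D"
    using \<open>hilbert_module_iso _ _ _ _ D\<close> by (simp add: hilbert_module_iso_def)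
  \<comment> \<open>At level 0, \<open>\<iota> 0 n\<close> is \<open>\<iota> 0 1\<close> acted on by
    \<open>n\<close>. Since \<open>R\<close> lowers the level by one and \<open>D\<close> is
    bijective, each further level costs one \<open>inv D\<close>.\<close>
  have Q_embed: "Q (\<iota> k n) = (inv D ^^ k) (actX \<phi> n)" for k n
  proof (induction k)
    case 0
    show ?case
      using Y.embed_act[of 0 1 n] act_Q \<open>Q (\<iota> 0 1) = \<phi>\<close> by simp
  next
    case (Suc k)
    have "D (Q (\<iota> (Suc k) n)) = Q (\<iota> k n)"
      using fun_cong[OF \<open>D \<circ> Q = Q \<circ> R\<close>, of "\<iota> (Suc k) n"] \<open>\<And>k n. R (\<iota> (Suc k) n) = \<iota> k n\<close> by simp
    then have "Q (\<iota> (Suc k) n) = inv D (Q (\<iota> k n))"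
      using bij_is_inj[OF \<open>bij D\<close>] by (metis inv_f_f)
    then show ?case
      by (simp add: Suc.IH)
  qed
  have wavelet: "wavelet \<alpha> actX D \<phi> m i = Q (Y.wavelet_vec i)" for i
  proof (cases i)
    case None
    then show ?thesis
      using \<open>Q (\<iota> 0 1) = \<phi>\<close> by (simp add: wavelet_def Y.wavelet_vec_def)
  next
    case (Some js)
    then show ?thesis
      by (simp add: wavelet_def Y.wavelet_vec_def Q_embed Y.word_eq_prod)
  qed
  have parseval: "parseval_frame actX ipX (range Q) (wavelet \<alpha> actX D \<phi> m) (wavelet_index J)"
    unfolding parseval_frame_def
  proof (intro conjI ballI)
    show "closed_submodule actX ipX (range Q)"
      by (rule closed_submodule_range_ip_preserving) fact+
    show "countable (wavelet_index J)"
      by (rule countableI_type)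
    show "wavelet \<alpha> actX D \<phi> m ` wavelet_index J \<subseteq> range Q"
      by (auto simp: wavelet)
    fix z assume "z \<in> range Q"
    then show "((\<lambda>j. ipX z (wavelet \<alpha> actX D \<phi> m j) * ipX (wavelet \<alpha> actX D \<phi> m j) z) has_sum ipX z z)
        (wavelet_index J)"
      using Y.has_sum_wavelet_vec by (auto simp: wavelet ip_Q)
  qed
  \<comment> \<open>The frame part already supplies generation; the orthonormality relations come
    from the limit because \<open>Q\<close> is isometric.\<close>
  moreover have "orthonormal_basis actX ipX (range Q) (wavelet \<alpha> actX D \<phi> m) (wavelet_index J)"
    if "orthonormal_basis (corr_act \<alpha>) (corr_ip L) UNIV m J"
  proof (rule X.orthonormal_basis_of_parseval_frame[OF parseval])
    fix i j assume "i \<in> wavelet_index J" "j \<in> wavelet_index J"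
    then show "ipX (wavelet \<alpha> actX D \<phi> m i) (wavelet \<alpha> actX D \<phi> m j) = (if i = j then 1 else 0)"
      using that unfolding wavelet ip_Q
      by (intro Y.ip_wavelet_vec) (auto simp: orthonormal_basis_def)
  qed
  ultimately show ?thesis
    by blast
qed

end
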